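(* Let $s\ge 3$ be an integer, and let $z(q)$ be the mirror map produced by the differential equation $$\bigl(\delta_z^{s-1}-sz(s\delta_z+1)(s\delta_z+2)\cdots(s\delta_z+s-1)\bigr)y=0,\qquad \delta_z=z\frac{\mathrm{d}}{\mathrm{d}z}.$$ Regard $z=z(e^t)$ as a function of $t=\log q$, and let $z',z'',\dots,z^{(k)},\dots$ denote its derivatives with respect to $t$. Then $z$ satisfies an algebraic differential equation (with respect to $\mathrm{d}/\mathrm{d}t$) of order $2s-3$ with coefficients from $\mathbb{C}$. Moreover, $z^{(2s-3)}$ is rational over the field $\mathbb{C}(z,z',\dots,z^{(2s-4)})$, i.e. $z^{(2s-3)}\in\mathbb{C}(z,z',\dots,z^{(2s-4)})$.
   Context: For an integer $s\ge 3$, the mirror map produced by the differential equation $$\bigl(\delta_z^{s-1}-sz(s\delta_z+1)(s\delta_z+2)\cdots(s\delta_z+s-1)\bigr)y=0,\qquad \delta_z=z\frac{\mathrm{d}}{\mathrm{d}z},$$ is defined as follows. Near $z=0$ this differential equation has the solutions $$f_0(z)=\sum_{l=0}^\infty\frac{(sl)!}{(l!)^s}z^l,\qquad f_1(z)=f_0(z)\log z+g_1(z),\qquad g_1(z)=s\sum_{l=1}^\infty\Bigl(\frac{(sl)!}{(l!)^s}\sum_{k=l+1}^{sl}\frac1k\Bigr)z^l.$$ Put $q(z)=\exp(f_1(z)/f_0(z))=z\exp(g_1(z)/f_0(z))$, which is analytic near $z=0$ with $q(z)=z+O(z^2)$. The mirror map $q\mapsto z(q)$ is the inverse function, analytic near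 $q=0$ with $z(q)=q+O(q^2)$. With $t=\log q$ one has $\mathrm{d}/\mathrm{d}t=q\,\mathrm{d}/\mathrm{d}q$. *)

theory Defs
  imports "HOL-Complex_Analysis.Complex_Analysis" "HOL-Library.Poly_Mapping"
begin

subsection \<open>Complex polynomials in the variables $X_0, X_1, X_2, \ldots$\<close>

text \<open>A monomial is its finitely supported exponent vector, and a polynomial is a finitely
  supported family of coefficients indexed by monomials.\<close>

type_synonym cmpoly = "(nat \<Rightarrow>\<^sub>0 nat) \<Rightarrow>\<^sub>0 complex"

definition cmpoly_eval :: "cmpoly \<Rightarrow> (nat \<Rightarrow> complex) \<Rightarrow> complex" where
  "cmpoly_eval P x =
     (\<Sum>m\<in>Poly_Mapping.keys P.
        Poly_Mapping.lookup P m * (\<Prod>i\<in>Poly_Mapping.keys m. x i ^ Poly_Mapping.lookup m i))"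

definition cmpoly_vars :: "cmpoly \<Rightarrow> nat set" where
  "cmpoly_vars P = (\<Union>m\<in>Poly_Mapping.keys P. Poly_Mapping.keys m)"

subsection \<open>Differential algebra of functions near $\mathrm{Re}\,t = -\infty$\<close>

text \<open>If $q = e^t$, then $q$ is near $0$ iff the real part of $t$ is near $-\infty$. A function
  that is analytic in $q$ near $0$ is thus regarded, as a function of $t$, up to equality on some
  left half-plane.\<close>

definition at_left_infinity :: "complex filter" where
  "at_left_infinity = filtercomap Re at_bot"

lemma eventually_at_left_infinity:
  "eventually P at_left_infinity \<longleftrightarrow> (\<exists>R. \<forall>t. Re t < R \<longrightarrow> P t)"
  by (auto simp: at_left_infinity_def eventually_filtercomap_at_bot_dense)

definition satisfies_algebraic_ode :: "nat \<Rightarrow> (complex \<Rightarrow> complex) \<Rightarrow> bool" where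
  "satisfies_algebraic_ode n y \<longleftrightarrow>
     (\<exists>P. cmpoly_vars P \<subseteq> {..n} \<and> n \<in> cmpoly_vars P \<and>
          (\<forall>\<^sub>F t in at_left_infinity. cmpoly_eval P (\<lambda>k. (deriv ^^ k) y t) = 0))"

text \<open>Membership of \<open>h\<close> in $\mathbb{C}(y, y', \ldots, y^{(m)})$. For \<open>y\<close> an analytic function of
  $e^t$, the denominator is such a function as well, so that it is either identically zero or
  without zeros on some left half-plane.\<close>

definition in_jet_field :: "nat \<Rightarrow> (complex \<Rightarrow> complex) \<Rightarrow> (complex \<Rightarrow> complex) \<Rightarrow> bool" where
  "in_jet_field m y h \<longleftrightarrow>
     (\<exists>A B. cmpoly_vars A \<subseteq> {..m} \<and> cmpoly_vars B \<subseteq> {..m} \<and>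
        (\<forall>\<^sub>F t in at_left_infinity.
           cmpoly_eval B (\<lambda>k. (deriv ^^ k) y t) \<noteq> 0 \<and>
           h t = cmpoly_eval A (\<lambda>k. (deriv ^^ k) y t) / cmpoly_eval B (\<lambda>k. (deriv ^^ k) y t)))"

subsection \<open>The mirror map\<close>

text \<open>The differential equation
  $(\delta_z^{s-1} - s z (s\delta_z+1)\cdots(s\delta_z+s-1))\,y = 0$ has, near $z = 0$, the
  solutions $f_0$ and $f_1 = f_0 \log z + g_1$. All three functions below are only
  meaningful near $z = 0$, where the series converge.\<close>

definition f0 :: "nat \<Rightarrow> complex \<Rightarrow> complex" where
  "f0 s z = suminf (\<lambda>l. fact (s * l) / fact l ^ s * z ^ l)"

text \<open>The term for \<open>l = 0\<close> vanishes since its inner sum is empty.\<close>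

definition g1 :: "nat \<Rightarrow> complex \<Rightarrow> complex" where
  "g1 s z = of_nat s *
     suminf (\<lambda>l. fact (s * l) / fact l ^ s * (\<Sum>k = l + 1..s * l. 1 / of_nat k) * z ^ l)"

text \<open>This is $\exp(f_1/f_0)$, independently of the branch of the logarithm.\<close>

definition q_coord :: "nat \<Rightarrow> complex \<Rightarrow> complex" where
  "q_coord s z = z * exp (g1 s z / f0 s z)"

text \<open>The mirror map is determined as a germ at \<open>0\<close>.\<close>

definition is_mirror_map :: "nat \<Rightarrow> (complex \<Rightarrow> complex) \<Rightarrow> bool" where
  "is_mirror_map s Z \<longleftrightarrow>
     Z analytic_on {0} \<and> Z 0 = 0 \<and> (\<forall>\<^sub>F q in nhds 0. q_coord s (Z q) = q)"

subsection \<open>Existence and uniqueness of the mirror map\<close>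

lemma mirror_coeff_bound: "fact (s * l) / fact l ^ s \<le> real (s ^ s) ^ l"
proof (induction l)
  case (Suc l)
  have "s \<le> s * Suc l" by simp
  have "fact (s * Suc l) = (fact (s * Suc l) div fact (s * Suc l - s)) * (fact (s * l) :: nat)"
    by (simp add: fact_dvd)
  also have "\<dots> \<le> (s * Suc l) ^ s * fact (s * l)"
    using fact_div_fact_le_pow[OF \<open>s \<le> s * Suc l\<close>] by (rule mult_right_mono) simp
  finally have "real (fact (s * Suc l)) \<le> real ((s * Suc l) ^ s * fact (s * l))"
    by (rule of_nat_mono)
  hence *: "fact (s * Suc l) \<le> real s ^ s * real (Suc l) ^ s * fact (s * l)"
    by (simp only: of_nat_fact of_nat_mult of_nat_power power_mult_distrib)
  have "fact (s * Suc l) / fact (Suc l) ^ s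
          \<le> real s ^ s * real (Suc l) ^ s * fact (s * l) / fact (Suc l) ^ s"
    using * by (rule divide_right_mono) simp
  also have "\<dots> = real s ^ s * (fact (s * l) / fact l ^ s)"
    by (simp add: power_mult_distrib del: of_nat_Suc)
  also have "\<dots> \<le> real s ^ s * real (s ^ s) ^ l"
    using Suc by (rule mult_left_mono) simp
  finally show ?case by simp
qed simp

lemma powser_holomorphic:
  fixes a :: "nat \<Rightarrow> complex"
  assumes bound: "\<And>l. norm (a l) \<le> C * K ^ l" and "K > 0"
  shows "(\<lambda>z. suminf (\<lambda>l. a l * z ^ l)) holomorphic_on ball 0 (1 / K)"
proof (rule power_series_holomorphic[where a = a])
  fix w :: complex assume "w \<in> ball 0 (1 / K)"
  hence w: "K * norm w < 1" using \<open>K > 0\<close> by (simp add: field_simps)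
  have "summable (\<lambda>l. a l * w ^ l)"
  proof (rule summable_comparison_test')
    show "summable (\<lambda>l. C * (K * norm w) ^ l)"
      using w \<open>K > 0\<close> by (intro summable_mult summable_geometric) simp
    show "norm (a l * w ^ l) \<le> C * (K * norm w) ^ l" for l
      using mult_right_mono[OF bound[of l], of "norm w ^ l"]
      by (simp add: norm_mult norm_power power_mult_distrib mult_ac)
  qed
  thus "(\<lambda>l. a l * (w - 0) ^ l) sums suminf (\<lambda>l. a l * w ^ l)"
    by (simp add: summable_sums)
qed

lemma q_coord_local:
  assumes "s \<ge> 1"
  obtains r where "r > 0" "q_coord s holomorphic_on ball 0 r" "inj_on (q_coord s) (ball 0 r)"
proof -
  define K where "K = 2 * real (s ^ s)"
  have K: "K > 0" using assms by (simp add: K_def)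
  have c: "norm (fact (s * l) / fact l ^ s :: complex) \<le> real (s ^ s) ^ l" for l
    using mirror_coeff_bound[of s l] by (simp add: norm_divide norm_power)
  have "f0 s holomorphic_on ball 0 (1 / K)"
    unfolding f0_def[abs_def]
  proof (rule powser_holomorphic[where C = 1, OF _ K])
    fix l
    have "real (s ^ s) ^ l \<le> K ^ l" by (rule power_mono) (simp_all add: K_def)
    thus "norm (fact (s * l) / fact l ^ s :: complex) \<le> 1 * K ^ l" using c[of l] by simp
  qed
  have holg: "g1 s holomorphic_on ball 0 (1 / K)"
    unfolding g1_def[abs_def]
  proof (intro holomorphic_on_mult holomorphic_on_const powser_holomorphic[where C = "real s", OF _ K])
    fix l
    have "norm (\<Sum>k = l + 1..s * l. 1 / of_nat k :: complex) \<le> (\<Sum>k = l + 1..s * l. 1)"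
      by (rule sum_norm_le) (simp add: norm_divide)
    also have "\<dots> = real (s * l - l)" by simp
    also have "\<dots> \<le> real (s * l)" by (rule of_nat_mono) simp
    also have "\<dots> \<le> real s * 2 ^ l"
      unfolding of_nat_mult
      by (intro mult_left_mono less_imp_le[OF of_nat_less_two_power]) simp
    finally have "norm (fact (s * l) / fact l ^ s * (\<Sum>k = l + 1..s * l. 1 / of_nat k :: complex))
        \<le> real (s ^ s) ^ l * (real s * 2 ^ l)"
      unfolding norm_mult using c by (intro mult_mono) auto
    thus "norm (fact (s * l) / fact l ^ s * (\<Sum>k = l + 1..s * l. 1 / of_nat k :: complex))
        \<le> real s * K ^ l"
      by (simp add: K_def power_mult_distrib mult_ac)
  qed
  have "f0 s 0 = 1" "g1 s 0 = 0"
    unfolding f0_def g1_def by (simp_all only: powser_zero) simp_all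
  have "isCont (f0 s) 0"
    using \<open>f0 s holomorphic_on _\<close> K
    by (intro continuous_on_interior[OF holomorphic_on_imp_continuous_on]) auto
  from continuous_at_avoid[OF this, of 0] obtain e
    where e: "e > 0" "\<And>z. dist 0 z < e \<Longrightarrow> f0 s z \<noteq> 0"
    using \<open>f0 s 0 = 1\<close> by auto
  define d where "d = min e (1 / K)"
  have d: "d > 0" using e K by (simp add: d_def)
  have holE: "(\<lambda>z. exp (g1 s z / f0 s z)) holomorphic_on ball 0 d"
    by (intro holomorphic_intros holomorphic_on_subset[OF holg]
          holomorphic_on_subset[OF \<open>f0 s holomorphic_on _\<close>]) (auto simp: d_def e)
  have holq: "q_coord s holomorphic_on ball 0 d"
    unfolding q_coord_def[abs_def] by (rule holomorphic_on_mult[OF holomorphic_on_ident holE])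
  have "((\<lambda>z. exp (g1 s z / f0 s z)) has_field_derivative
          deriv (\<lambda>z. exp (g1 s z / f0 s z)) 0) (at 0)"
    using holomorphic_derivI[OF holE] d by simp
  from DERIV_mult[OF DERIV_ident this] have "deriv (q_coord s) 0 = 1"
    unfolding q_coord_def[abs_def]
    by (intro DERIV_imp_deriv) (simp add: \<open>f0 s 0 = 1\<close> \<open>g1 s 0 = 0\<close>)
  hence nz: "deriv (q_coord s) 0 \<noteq> 0" by simp
  have "0 \<in> ball (0 :: complex) d" using d by simp
  from has_complex_derivative_locally_invertible[OF holq this open_ball nz] obtain r
    where "r > 0" "ball 0 r \<subseteq> ball (0 :: complex) d" "inj_on (q_coord s) (ball 0 r)" .
  thus ?thesis using holq by (intro that[of r] holomorphic_on_subset[OF holq])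
qed

lemma mirror_map_exists:
  assumes "s \<ge> 1"
  shows "\<exists>Z. is_mirror_map s Z"
proof -
  obtain r where r: "r > 0" "q_coord s holomorphic_on ball 0 r" "inj_on (q_coord s) (ball 0 r)"
    using q_coord_local[OF assms] .
  obtain Z where Z: "Z holomorphic_on q_coord s ` ball 0 r"
      "\<And>z. z \<in> ball 0 r \<Longrightarrow> Z (q_coord s z) = z"
    using holomorphic_has_inverse[OF r(2) open_ball r(3)] by metis
  have op: "open (q_coord s ` ball 0 r)" by (rule open_mapping_thm3[OF r(2) open_ball r(3)])
  have q0: "q_coord s 0 = 0" by (simp add: q_coord_def)
  have mem: "0 \<in> q_coord s ` ball 0 r" using q0 r(1) by (auto intro!: image_eqI[of _ _ 0])
  have "Z analytic_on {0}"
    using Z(1) op mem by (auto simp: analytic_at)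
  moreover have "Z 0 = 0" using Z(2)[of 0] r(1) q0 by simp
  moreover have "\<forall>\<^sub>F q in nhds 0. q_coord s (Z q) = q"
    using eventually_nhds_in_open[OF op mem] by eventually_elim (auto simp: Z(2))
  ultimately show ?thesis unfolding is_mirror_map_def by blast
qed

lemma mirror_map_unique:
  assumes "s \<ge> 1" "is_mirror_map s Z" "is_mirror_map s W"
  shows "\<forall>\<^sub>F q in nhds 0. Z q = W q"
proof -
  obtain r where r: "r > 0" "inj_on (q_coord s) (ball 0 r)"
    using q_coord_local[OF assms(1)] by metis
  have small: "\<forall>\<^sub>F q in nhds 0. V q \<in> ball 0 r" if "is_mirror_map s V" for V
  proof -
    have "isCont V 0" using that by (auto simp: is_mirror_map_def intro: analytic_at_imp_isCont)
    hence "filterlim V (nhds 0) (nhds 0)"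
      using that by (simp add: is_mirror_map_def isCont_def tendsto_at_iff_tendsto_nhds)
    from topological_tendstoD[OF this open_ball, of 0 r] show ?thesis using r(1) by simp
  qed
  have "\<forall>\<^sub>F q in nhds 0. q_coord s (Z q) = q" "\<forall>\<^sub>F q in nhds 0. q_coord s (W q) = q"
    using assms by (auto simp: is_mirror_map_def)
  with small[OF assms(2)] small[OF assms(3)] show ?thesis
    by eventually_elim (metis inj_onD[OF r(2)])
qed

end

theory Submission
  imports Defs "Jordan_Normal_Form.Determinant"
begin

text \<open>Write $n = s - 1$, $\delta = z\,\mathrm{d}/\mathrm{d}z$ and $\tau_j = \delta^j t$. Both $f_0$ and
  $f_1 = t f_0$ are killed by the operator of order $n$, so their $\delta$-derivatives of orders
  $n, \ldots, 2n - 1$ reduce to those of order less than $n$ with the same coefficients, which are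
  rational functions of $z$. Comparing the two reductions by the Leibniz rule gives $n$ linear
  relations among $f_0, \delta f_0, \ldots, \delta^{n-1} f_0$ with coefficients rational in
  $z, \tau_1, \ldots, \tau_{2n-1}$. Their determinant vanishes, it is linear in $\tau_{2n-1}$, and the
  cofactor multiplying $\tau_{2n-1}$ is a nonzero rational function of the other variables. If that
  cofactor does not vanish on the actual functions, then $\tau_{2n-1}$ is rational in the earlier
  variables. Otherwise some $\tau_m$ with $m < 2n - 1$ is algebraic over its predecessors, and
  differentiating a relation of minimal degree shows that $\tau_{m+1}$, and then every later $\tau_k$,
  is rational in its predecessors. Finally $z, \tau_1, \ldots, \tau_k$ and $z, z', \ldots, z^{(k)}$
  generate the same field for $k \ge 1$.\<close>

text \<open>Reductions of order less than \<open>n\<close> are trivial, so the \<open>n\<close>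
  relations needed for \<open>n\<close> unknowns have orders \<open>n\<close> to
  \<open>2 * n - 1\<close>. Only the last of them contains \<tau>_(2n-1), and with
  \<open>n = s - 1\<close> its index is \<open>2 * s - 3\<close>. The vector of unknowns is nonzero
  because \<open>f0\<close> is 1 at the origin.

  The obstacle is that a cofactor which is nonzero as a rational function may still vanish on the
  actual germs, and no algebraic independence of \<open>z\<close>, \<tau>_1, \<tau>_2, ... is
  established. Instead both cases are led to the same conclusion inside fields of germs that are
  meromorphic in \<open>q = exp t\<close>. Far enough to the left such a germ is either zero or free
  of zeros, so it can be inverted unless it is zero. The function \<open>t = log q\<close> is not
  such a germ; it is therefore essential that \<tau>_0 = \<open>t\<close> cancels from all
  relations, and the place with index 0 is given to \<open>z\<close>.\<close>

subsection \<open>Germs meromorphic in the exponential\<close>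

text \<open>Left half-planes are open. This is what allows identities that hold eventually to be
  differentiated.\<close>

lemma eventually_at_left_infinity_nhds:
  assumes "\<forall>\<^sub>F t in at_left_infinity. P t"
  shows "\<forall>\<^sub>F t in at_left_infinity. \<forall>\<^sub>F u in nhds t. P u"
proof -
  obtain R where R: "\<And>t. Re t < R \<Longrightarrow> P t"
    using assms by (auto simp: eventually_at_left_infinity)
  have "\<forall>\<^sub>F u in nhds t. P u" if "Re t < R" for t
    using eventually_nhds_in_open[OF open_halfspace_Re_lt[of R], of t] that R
    by (auto elim!: eventually_mono)
  thus ?thesis
    by (auto simp: eventually_at_left_infinity)
qed

lemma at_left_infinity_neq_bot [simp]: "at_left_infinity \<noteq> bot"
proof
  assume "at_left_infinity = bot"
  hence "eventually (\<lambda>_. False) at_left_infinity" by simp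
  then obtain R where "\<And>t. \<not> Re t < R" by (auto simp: eventually_at_left_infinity)
  from this[of "of_real (R - 1)"] show False by simp
qed

lemma filterlim_exp_at_left_infinity: "filterlim exp (at 0) at_left_infinity"
proof -
  have "filterlim (\<lambda>t. exp (Re t)) (nhds 0) at_left_infinity"
    unfolding at_left_infinity_def by (intro filterlim_compose[OF exp_at_bot] filterlim_filtercomap)
  hence "(exp \<longlongrightarrow> (0 :: complex)) at_left_infinity"
    by (intro tendsto_norm_zero_cancel[of exp]) (simp add: norm_exp_eq_Re)
  thus ?thesis
    by (simp add: filterlim_at)
qed

lemma eventually_deriv_cong:
  assumes "\<forall>\<^sub>F t in at_left_infinity. f t = g t"
  shows "\<forall>\<^sub>F t in at_left_infinity. deriv f t = deriv g t"
  using eventually_at_left_infinity_nhds[OF assms]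
  by eventually_elim (rule deriv_cong_ev, auto)

lemma eventually_has_field_derivative_cong:
  assumes "\<forall>\<^sub>F t in at_left_infinity. f t = g t"
    and "\<forall>\<^sub>F t in at_left_infinity. (f has_field_derivative D t) (at t)"
  shows "\<forall>\<^sub>F t in at_left_infinity. (g has_field_derivative D t) (at t)"
  using eventually_at_left_infinity_nhds[OF assms(1)] assms(2)
  by eventually_elim (use DERIV_cong_ev in blast)

text \<open>Meromorphic rather than analytic in \<open>q = exp t\<close>, so that inverses stay in
  the class. Values at isolated points do not matter, since only a punctured neighbourhood of
  \<open>q = 0\<close> is seen.\<close>

definition meromorphic_in_exp :: "(complex \<Rightarrow> complex) \<Rightarrow> bool" where
  "meromorphic_in_exp h \<longleftrightarrow>
     (\<exists>H. H meromorphic_on {0} \<and> (\<forall>\<^sub>F t in at_left_infinity. h t = H (exp t)))"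

lemma eventually_exp:
  "eventually P (at 0) \<Longrightarrow> \<forall>\<^sub>F t in at_left_infinity. P (exp t)"
  using filterlim_exp_at_left_infinity by (auto simp: filterlim_iff)

lemma meromorphic_in_exp_cong:
  assumes "meromorphic_in_exp f" "\<forall>\<^sub>F t in at_left_infinity. f t = g t"
  shows "meromorphic_in_exp g"
proof -
  obtain H where H: "H meromorphic_on {0}" "\<forall>\<^sub>F t in at_left_infinity. f t = H (exp t)"
    using assms(1) by (auto simp: meromorphic_in_exp_def)
  from H(2) assms(2) have "\<forall>\<^sub>F t in at_left_infinity. g t = H (exp t)"
    by eventually_elim simp
  with H(1) show ?thesis by (auto simp: meromorphic_in_exp_def)
qed

lemma meromorphic_in_exp_const: "meromorphic_in_exp (\<lambda>_. c)"
  unfolding meromorphic_in_exp_def by (intro exI[of _ "\<lambda>_. c"]) auto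

lemma meromorphic_in_exp_add:
  assumes "meromorphic_in_exp f" "meromorphic_in_exp g"
  shows "meromorphic_in_exp (\<lambda>t. f t + g t)"
proof -
  obtain F G where F: "F meromorphic_on {0}" "\<forall>\<^sub>F t in at_left_infinity. f t = F (exp t)"
    and G: "G meromorphic_on {0}" "\<forall>\<^sub>F t in at_left_infinity. g t = G (exp t)"
    using assms by (auto simp: meromorphic_in_exp_def)
  from F(2) G(2) have "\<forall>\<^sub>F t in at_left_infinity. f t + g t = (\<lambda>q. F q + G q) (exp t)"
    by eventually_elim simp
  thus ?thesis
    unfolding meromorphic_in_exp_def using meromorphic_on_add[OF F(1) G(1)] by blast
qed

lemma meromorphic_in_exp_mult:
  assumes "meromorphic_in_exp f" "meromorphic_in_exp g"
  shows "meromorphic_in_exp (\<lambda>t. f t * g t)"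
proof -
  obtain F G where F: "F meromorphic_on {0}" "\<forall>\<^sub>F t in at_left_infinity. f t = F (exp t)"
    and G: "G meromorphic_on {0}" "\<forall>\<^sub>F t in at_left_infinity. g t = G (exp t)"
    using assms by (auto simp: meromorphic_in_exp_def)
  from F(2) G(2) have "\<forall>\<^sub>F t in at_left_infinity. f t * g t = (\<lambda>q. F q * G q) (exp t)"
    by eventually_elim simp
  thus ?thesis
    unfolding meromorphic_in_exp_def using meromorphic_on_mult[OF F(1) G(1)] by blast
qed

lemma meromorphic_in_exp_inverse:
  assumes "meromorphic_in_exp f"
  shows "meromorphic_in_exp (\<lambda>t. inverse (f t))"
proof -
  obtain F where F: "F meromorphic_on {0}" "\<forall>\<^sub>F t in at_left_infinity. f t = F (exp t)"
    using assms by (auto simp: meromorphic_in_exp_def)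
  from F(2) have "\<forall>\<^sub>F t in at_left_infinity. inverse (f t) = (\<lambda>q. inverse (F q)) (exp t)"
    by eventually_elim simp
  thus ?thesis
    unfolding meromorphic_in_exp_def using meromorphic_on_inverse[OF F(1)] by blast
qed

text \<open>In terms of \<open>q = exp t\<close> the operator d/dt is \<open>q\<close> d/dq, and a
  function meromorphic at 0 is analytic on a punctured neighbourhood of 0.\<close>

lemma meromorphic_in_exp_deriv:
  assumes "meromorphic_in_exp f"
  shows "meromorphic_in_exp (deriv f)"
    and "\<forall>\<^sub>F t in at_left_infinity. (f has_field_derivative deriv f t) (at t)"
proof -
  obtain F where F: "F meromorphic_on {0}" "\<forall>\<^sub>F t in at_left_infinity. f t = F (exp t)"
    using assms by (auto simp: meromorphic_in_exp_def)
  have "\<forall>\<^sub>F q in at 0. F analytic_on {q}"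
    using F(1) by (auto simp: meromorphic_at_iff isolated_singularity_at_altdef)
  hence "\<forall>\<^sub>F t in at_left_infinity. F analytic_on {exp t}"
    by (rule eventually_exp)
  hence *: "\<forall>\<^sub>F t in at_left_infinity.
      ((\<lambda>t. F (exp t)) has_field_derivative deriv F (exp t) * exp t) (at t)"
  proof eventually_elim
    case (elim t)
    hence "(F has_field_derivative deriv F (exp t)) (at (exp t))"
      using analytic_on_imp_differentiable_at field_differentiable_derivI by blast
    from DERIV_chain2[OF this DERIV_exp] show ?case .
  qed
  have "\<forall>\<^sub>F t in at_left_infinity. F (exp t) = f t"
    using F(2) by eventually_elim simp
  from eventually_has_field_derivative_cong[OF this *]
  have **: "\<forall>\<^sub>F t in at_left_infinity. (f has_field_derivative deriv F (exp t) * exp t) (at t)" .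
  thus "\<forall>\<^sub>F t in at_left_infinity. (f has_field_derivative deriv f t) (at t)"
    by eventually_elim (use DERIV_imp_deriv in force)
  from ** have "\<forall>\<^sub>F t in at_left_infinity. deriv f t = (\<lambda>q. deriv F q * q) (exp t)"
    by eventually_elim (use DERIV_imp_deriv in force)
  moreover have "(\<lambda>q. deriv F q * q) meromorphic_on {0}"
    by (intro meromorphic_intros F(1))
  ultimately show "meromorphic_in_exp (deriv f)"
    unfolding meromorphic_in_exp_def by blast
qed

text \<open>Zeros of a meromorphic function that is not locally zero cannot accumulate at 0. This
  turns "not the zero germ" into "invertible".\<close>

lemma meromorphic_in_exp_dichotomy:
  assumes "meromorphic_in_exp f"
  shows "(\<forall>\<^sub>F t in at_left_infinity. f t = 0) \<or> (\<forall>\<^sub>F t in at_left_infinity. f t \<noteq> 0)"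
proof -
  obtain F where F: "F meromorphic_on {0}" "\<forall>\<^sub>F t in at_left_infinity. f t = F (exp t)"
    using assms by (auto simp: meromorphic_in_exp_def)
  have iso: "isolated_singularity_at F 0" "not_essential F 0"
    using F(1) by (auto simp: meromorphic_at_iff)
  show ?thesis
  proof (cases "\<forall>\<^sub>F q in at 0. F q = 0")
    case True
    from eventually_exp[OF this] F(2) have "\<forall>\<^sub>F t in at_left_infinity. f t = 0"
      by eventually_elim simp
    thus ?thesis ..
  next
    case False
    hence "\<exists>\<^sub>F q in at 0. F q \<noteq> 0" by (simp add: frequently_def)
    hence "\<forall>\<^sub>F q in at 0. F q \<noteq> 0"
      using non_zero_neighbour[OF iso] by simp
    from eventually_exp[OF this] F(2) have "\<forall>\<^sub>F t in at_left_infinity. f t \<noteq> 0"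
      by eventually_elim simp
    thus ?thesis ..
  qed
qed

section \<open>Fields generated by germs\<close>

text \<open>The inverse is the total one, so the inverse of the zero germ is zero.\<close>

inductive_set germ_field :: "(complex \<Rightarrow> complex) set \<Rightarrow> (complex \<Rightarrow> complex) set"
  for G where
  gen: "g \<in> G \<Longrightarrow> g \<in> germ_field G"
| const: "(\<lambda>_. c) \<in> germ_field G"
| add: "f \<in> germ_field G \<Longrightarrow> g \<in> germ_field G \<Longrightarrow> (\<lambda>t. f t + g t) \<in> germ_field G"
| mult: "f \<in> germ_field G \<Longrightarrow> g \<in> germ_field G \<Longrightarrow> (\<lambda>t. f t * g t) \<in> germ_field G"
| inverse: "f \<in> germ_field G \<Longrightarrow> (\<lambda>t. inverse (f t)) \<in> germ_field G"
| cong: "f \<in> germ_field G \<Longrightarrow> \<forall>\<^sub>F t in at_left_infinity. f t = g t \<Longrightarrow> g \<in> germ_field G"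

lemma germ_field_divide:
  "f \<in> germ_field G \<Longrightarrow> g \<in> germ_field G \<Longrightarrow> (\<lambda>t. f t / g t) \<in> germ_field G"
  unfolding divide_inverse by (intro germ_field.mult germ_field.inverse)

lemma germ_field_power:
  "f \<in> germ_field G \<Longrightarrow> (\<lambda>t. f t ^ k) \<in> germ_field G"
  by (induction k) (auto intro: germ_field.const germ_field.mult)

lemma germ_field_sum:
  "(\<And>i. i \<in> I \<Longrightarrow> f i \<in> germ_field G) \<Longrightarrow> (\<lambda>t. \<Sum>i\<in>I. f i t) \<in> germ_field G"
  by (induction I rule: infinite_finite_induct) (auto intro: germ_field.const germ_field.add)

lemma germ_field_uminus:
  "f \<in> germ_field G \<Longrightarrow> (\<lambda>t. - f t) \<in> germ_field G"
  using germ_field.mult[OF germ_field.const[of "-1"], of f] by simp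

lemma germ_field_least:
  assumes "G \<subseteq> germ_field H"
  shows "germ_field G \<subseteq> germ_field H"
proof
  fix f assume "f \<in> germ_field G"
  thus "f \<in> germ_field H"
  proof induction
    case (cong f g)
    from cong.IH cong.hyps(2) show ?case by (rule germ_field.cong)
  qed (use assms in \<open>auto intro: germ_field.const germ_field.add germ_field.mult germ_field.inverse\<close>)
qed

lemma germ_field_mono: "G \<subseteq> H \<Longrightarrow> germ_field G \<subseteq> germ_field H"
  by (rule germ_field_least) (auto intro: germ_field.gen)

lemma germ_field_meromorphic:
  assumes "f \<in> germ_field G" and "\<And>g. g \<in> G \<Longrightarrow> meromorphic_in_exp g"
  shows "meromorphic_in_exp f"
  using assms(1)
proof induction
  case (cong f g)
  from cong.IH cong.hyps(2) show ?case by (rule meromorphic_in_exp_cong)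
qed (auto intro: assms(2) meromorphic_in_exp_const meromorphic_in_exp_add
      meromorphic_in_exp_mult meromorphic_in_exp_inverse)

text \<open>Differentiation raises the order of a jet, hence the second, larger field. Meromorphy of
  the generators supplies differentiability for the product rule and, for inverses, the dichotomy:
  the quotient rule applies off the zero germ, while the total inverse of the zero germ is
  constant.\<close>

lemma germ_field_deriv:
  assumes "f \<in> germ_field G"
    and mer: "\<And>g. g \<in> G \<Longrightarrow> meromorphic_in_exp g"
    and der: "\<And>g. g \<in> G \<Longrightarrow> deriv g \<in> germ_field H"
    and GH: "G \<subseteq> germ_field H"
  shows "deriv f \<in> germ_field H"
proof -
  have differentiable: "\<forall>\<^sub>F t in at_left_infinity. (h has_field_derivative deriv h t) (at t)"
    if "h \<in> germ_field G" for h
    by (rule meromorphic_in_exp_deriv(2)[OF germ_field_meromorphic[OF that mer]])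
  from assms(1) show ?thesis
  proof induction
    case (gen g)
    thus ?case by (rule der)
  next
    case (const c)
    thus ?case by (simp add: germ_field.const)
  next
    case (add f g)
    have "\<forall>\<^sub>F t in at_left_infinity. deriv f t + deriv g t = deriv (\<lambda>t. f t + g t) t"
      using add.hyps[THEN differentiable]
      by eventually_elim (rule DERIV_imp_deriv[symmetric], auto intro!: derivative_eq_intros)
    with add.IH show ?case by (rule germ_field.cong[OF germ_field.add])
  next
    case (mult f g)
    have "\<forall>\<^sub>F t in at_left_infinity.
        deriv f t * g t + deriv g t * f t = deriv (\<lambda>t. f t * g t) t"
      using mult.hyps[THEN differentiable]
      by eventually_elim (rule DERIV_imp_deriv[symmetric], auto intro!: derivative_eq_intros)
    moreover have "f \<in> germ_field H" "g \<in> germ_field H"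
      using mult.hyps germ_field_least[OF GH] by auto
    ultimately show ?case using mult.IH
      by - (rule germ_field.cong[where f = "\<lambda>t. deriv f t * g t + deriv g t * f t"],
          (intro germ_field.add germ_field.mult | assumption)+)
  next
    case (inverse f)
    have m: "meromorphic_in_exp f"
      using inverse.hyps mer by (rule germ_field_meromorphic)
    from meromorphic_in_exp_dichotomy[OF this] show ?case
    proof
      assume "\<forall>\<^sub>F t in at_left_infinity. f t = 0"
      hence "\<forall>\<^sub>F t in at_left_infinity. inverse (f t) = 0"
        by eventually_elim simp
      from eventually_deriv_cong[OF this]
      have "\<forall>\<^sub>F t in at_left_infinity. 0 = deriv (\<lambda>t. inverse (f t)) t"
        by eventually_elim simp
      thus ?thesis by (rule germ_field.cong[OF germ_field.const])
    next
      assume "\<forall>\<^sub>F t in at_left_infinity. f t \<noteq> 0"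
      with meromorphic_in_exp_deriv(2)[OF m]
      have "\<forall>\<^sub>F t in at_left_infinity.
          - (inverse (f t) * deriv f t * inverse (f t)) = deriv (\<lambda>t. inverse (f t)) t"
        by eventually_elim (rule DERIV_imp_deriv[symmetric], auto intro!: derivative_eq_intros)
      moreover have "f \<in> germ_field H"
        using inverse.hyps germ_field_least[OF GH] by auto
      ultimately show ?thesis using inverse.IH
        by - (rule germ_field.cong[where f = "\<lambda>t. - (inverse (f t) * deriv f t * inverse (f t))"],
            (intro germ_field_uminus germ_field.mult germ_field.inverse | assumption)+)
    qed
  next
    case (cong f g)
    from cong.IH eventually_deriv_cong[OF cong.hyps(2)] show ?case
      by (rule germ_field.cong)
  qed
qed

subsection \<open>Polynomial functions\<close>

text \<open>Products enter only as multiplication by a variable. Inductions such as those extracting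
  coefficients or a formal polynomial then meet no general product.\<close>

inductive_set polyfun :: "nat set \<Rightarrow> ((nat \<Rightarrow> complex) \<Rightarrow> complex) set" for V where
  const: "(\<lambda>_. c) \<in> polyfun V"
| add: "f \<in> polyfun V \<Longrightarrow> g \<in> polyfun V \<Longrightarrow> (\<lambda>x. f x + g x) \<in> polyfun V"
| var_mult: "i \<in> V \<Longrightarrow> f \<in> polyfun V \<Longrightarrow> (\<lambda>x. x i * f x) \<in> polyfun V"

lemma polyfun_var: "i \<in> V \<Longrightarrow> (\<lambda>x. x i) \<in> polyfun V"
  using polyfun.var_mult[OF _ polyfun.const[of 1]] by simp

lemma polyfun_mult:
  assumes "f \<in> polyfun V" "g \<in> polyfun V"
  shows "(\<lambda>x. f x * g x) \<in> polyfun V"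
  using assms(1)
proof induction
  case (const c)
  from assms(2) show ?case
  proof induction
    case (var_mult i f)
    thus ?case using polyfun.var_mult[of i V "\<lambda>x. c * f x"] by (simp add: mult_ac)
  qed (auto simp: distrib_left intro: polyfun.const polyfun.add)
next
  case (add f h)
  thus ?case by (auto simp: distrib_right intro: polyfun.add)
next
  case (var_mult i f)
  thus ?case using polyfun.var_mult[of i V "\<lambda>x. f x * g x"] by (simp add: mult_ac)
qed

lemma polyfun_power: "f \<in> polyfun V \<Longrightarrow> (\<lambda>x. f x ^ k) \<in> polyfun V"
  by (induction k) (auto intro: polyfun.const polyfun_mult)

lemma polyfun_diff:
  assumes "f \<in> polyfun V" "g \<in> polyfun V"
  shows "(\<lambda>x. f x - g x) \<in> polyfun V"
  using polyfun.add[OF assms(1) polyfun_mult[OF polyfun.const[of "-1"] assms(2)]] by simp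

lemma polyfun_mono:
  assumes "f \<in> polyfun V" "V \<subseteq> W"
  shows "f \<in> polyfun W"
  using assms(1) by induction (use assms(2) in \<open>auto intro: polyfun.intros\<close>)

lemma polyfun_germ_field:
  assumes "f \<in> polyfun V"
  shows "(\<lambda>t. f (\<lambda>i. x i t)) \<in> germ_field (x ` V)"
  using assms
proof induction
  case (var_mult i f)
  thus ?case by (intro germ_field.mult[OF germ_field.gen]) auto
qed (auto intro: germ_field.const germ_field.add)

lemma polyfun_empty: "f \<in> polyfun {} \<Longrightarrow> \<exists>c. f = (\<lambda>_. c)"
  by (induction rule: polyfun.induct) auto

lemma polyfun_coeffs:
  assumes "f \<in> polyfun (insert m V)"
  shows "\<exists>d a. (\<forall>k. a k \<in> polyfun V) \<and> (\<forall>x. f x = (\<Sum>k\<le>d. a k x * x m ^ k))"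
proof -
  \<comment> \<open>Vanishing of \<open>a k\<close> above \<open>d\<close> is added so that two
    expansions can be padded to a common degree in the case of a sum.\<close>
  have "\<exists>d a. (\<forall>k. a k \<in> polyfun V) \<and> (\<forall>k>d. a k = (\<lambda>_. 0)) \<and>
          (\<forall>x. f x = (\<Sum>k\<le>d. a k x * x m ^ k))"
    using assms
  proof induction
    case (const c)
    thus ?case
      by (intro exI[of _ 0] exI[of _ "\<lambda>k. if k = 0 then (\<lambda>_. c) else (\<lambda>_. 0)"])
         (auto intro: polyfun.const)
  next
    case (add f g)
    from add.IH obtain d a e b
      where a: "\<forall>k. a k \<in> polyfun V" "\<forall>k>d. a k = (\<lambda>_. 0)" "\<forall>x. f x = (\<Sum>k\<le>d. a k x * x m ^ k)"
        and b: "\<forall>k. b k \<in> polyfun V" "\<forall>k>e. b k = (\<lambda>_. 0)" "\<forall>x. g x = (\<Sum>k\<le>e. b k x * x m ^ k)"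
      by blast
    have "f x = (\<Sum>k\<le>max d e. a k x * x m ^ k)" for x
      unfolding a(3)[rule_format] using a(2) by (intro sum.mono_neutral_left) auto
    moreover have "g x = (\<Sum>k\<le>max d e. b k x * x m ^ k)" for x
      unfolding b(3)[rule_format] using b(2) by (intro sum.mono_neutral_left) auto
    ultimately show ?case using a(1,2) b(1,2)
      by (intro exI[of _ "max d e"] exI[of _ "\<lambda>k x. a k x + b k x"])
         (auto simp: sum.distrib distrib_right intro: polyfun.add)
  next
    case (var_mult i f)
    from var_mult.IH obtain d a
      where a: "\<forall>k. a k \<in> polyfun V" "\<forall>k>d. a k = (\<lambda>_. 0)" "\<forall>x. f x = (\<Sum>k\<le>d. a k x * x m ^ k)"
      by blast
    show ?case
    proof (cases "i = m")
      case True
      define b where "b k = (if k = 0 then (\<lambda>_. 0) else a (k - 1))" for k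
      have "x i * f x = (\<Sum>k\<le>Suc d. b k x * x m ^ k)" for x
        unfolding sum.atMost_Suc_shift a(3)[rule_format] sum_distrib_left
        by (simp add: b_def True mult_ac)
      moreover have "\<forall>k. b k \<in> polyfun V" "\<forall>k>Suc d. b k = (\<lambda>_. 0)"
        using a(1,2) by (auto simp: b_def intro: polyfun.const)
      ultimately show ?thesis by blast
    next
      case False
      with var_mult.hyps have "i \<in> V" by simp
      with a show ?thesis
        by (intro exI[of _ d] exI[of _ "\<lambda>k x. x i * a k x"])
           (auto simp: sum_distrib_left mult_ac intro: polyfun.var_mult)
    qed
  qed
  thus ?thesis by blast
qed

subsection \<open>Polynomial functions and formal polynomials\<close>

definition monomial_eval :: "(nat \<Rightarrow>\<^sub>0 nat) \<Rightarrow> (nat \<Rightarrow> complex) \<Rightarrow> complex" where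
  "monomial_eval m x = (\<Prod>i\<in>Poly_Mapping.keys m. x i ^ Poly_Mapping.lookup m i)"

lemma monomial_eval_superset:
  assumes "finite A" "Poly_Mapping.keys m \<subseteq> A"
  shows "monomial_eval m x = (\<Prod>i\<in>A. x i ^ Poly_Mapping.lookup m i)"
  unfolding monomial_eval_def using assms
  by (intro prod.mono_neutral_left) (auto simp: in_keys_iff)

lemma monomial_eval_var_mult:
  "monomial_eval (m + Poly_Mapping.single i 1) x = x i * monomial_eval m x"
proof -
  define A where "A = insert i (Poly_Mapping.keys m)"
  have A: "finite A" "Poly_Mapping.keys m \<subseteq> A" "Poly_Mapping.keys (m + Poly_Mapping.single i 1) \<subseteq> A"
    using Poly_Mapping.keys_add[of m "Poly_Mapping.single i 1"] by (auto simp: A_def split: if_splits)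
  have "monomial_eval (m + Poly_Mapping.single i 1) x =
      (\<Prod>j\<in>A. x j ^ Poly_Mapping.lookup m j * (if j = i then x i else 1))"
    unfolding monomial_eval_superset[OF A(1,3)]
    by (rule prod.cong) (auto simp: lookup_add lookup_single when_def)
  also have "\<dots> = (\<Prod>j\<in>A. x j ^ Poly_Mapping.lookup m j) * x i"
    using A(1) by (simp add: prod.distrib prod.delta A_def)
  finally show ?thesis
    unfolding monomial_eval_superset[OF A(1,2)] by (simp add: mult_ac)
qed

lemma cmpoly_eval_superset:
  assumes "finite S" "Poly_Mapping.keys P \<subseteq> S"
  shows "cmpoly_eval P x = (\<Sum>m\<in>S. Poly_Mapping.lookup P m * monomial_eval m x)"
  unfolding cmpoly_eval_def monomial_eval_def[symmetric] using assms
  by (intro sum.mono_neutral_left) (auto simp: in_keys_iff)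

lemma cmpoly_eval_add: "cmpoly_eval (P + Q) x = cmpoly_eval P x + cmpoly_eval Q x"
proof -
  define S where "S = Poly_Mapping.keys P \<union> Poly_Mapping.keys Q"
  have S: "finite S" "Poly_Mapping.keys P \<subseteq> S" "Poly_Mapping.keys Q \<subseteq> S"
      "Poly_Mapping.keys (P + Q) \<subseteq> S"
    using Poly_Mapping.keys_add[of P Q] by (auto simp: S_def)
  show ?thesis
    unfolding cmpoly_eval_superset[OF S(1,2)] cmpoly_eval_superset[OF S(1,3)] cmpoly_eval_superset[OF S(1,4)]
    by (simp add: lookup_add distrib_right sum.distrib)
qed

lemma cmpoly_eval_single: "cmpoly_eval (Poly_Mapping.single m c) x = c * monomial_eval m x"
  by (subst cmpoly_eval_superset[of "{m}"]) auto

lemma cmpoly_eval_cong: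
  assumes "\<And>i. i \<in> cmpoly_vars P \<Longrightarrow> x i = y i"
  shows "cmpoly_eval P x = cmpoly_eval P y"
proof -
  have "x i = y i" if "m \<in> Poly_Mapping.keys P" "i \<in> Poly_Mapping.keys m" for m i
    using that assms by (auto simp: cmpoly_vars_def)
  thus ?thesis by (simp add: cmpoly_eval_def)
qed

text \<open>A list of coefficients and monomials, repetitions allowed, serves as intermediate form:
  sums become concatenations and cancellation need not be tracked. Adding up the list at the end can
  only lose monomials, so the bound on the variables survives.\<close>

lemma polyfun_imp_cmpoly:
  assumes "f \<in> polyfun V"
  obtains P where "cmpoly_vars P \<subseteq> V" "cmpoly_eval P = f"
proof -
  from assms obtain ms where
    "(\<forall>(c, m)\<in>set ms. Poly_Mapping.keys m \<subseteq> V) \<and>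
     (\<forall>x. f x = (\<Sum>(c, m)\<leftarrow>ms. c * monomial_eval m x))"
  proof (induction arbitrary: thesis)
    case (const c)
    show ?case by (rule const[of "[(c, 0)]"]) (simp add: monomial_eval_def)
  next
    case (add f g)
    obtain ms ns where
      "(\<forall>(c, m)\<in>set ms. Poly_Mapping.keys m \<subseteq> V) \<and>
       (\<forall>x. f x = (\<Sum>(c, m)\<leftarrow>ms. c * monomial_eval m x))"
      "(\<forall>(c, m)\<in>set ns. Poly_Mapping.keys m \<subseteq> V) \<and>
       (\<forall>x. g x = (\<Sum>(c, m)\<leftarrow>ns. c * monomial_eval m x))"
      using add.IH by metis
    thus ?case by (intro add.prems[of "ms @ ns"]) auto
  next
    case (var_mult i f)
    obtain ms where ms:
      "(\<forall>(c, m)\<in>set ms. Poly_Mapping.keys m \<subseteq> V) \<and>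
       (\<forall>x. f x = (\<Sum>(c, m)\<leftarrow>ms. c * monomial_eval m x))"
      using var_mult.IH by metis
    have keys: "Poly_Mapping.keys (m + Poly_Mapping.single i 1) \<subseteq> V"
      if "Poly_Mapping.keys m \<subseteq> V" for m
      using Poly_Mapping.keys_add[of m "Poly_Mapping.single i 1"] that var_mult.hyps(1)
      by (auto split: if_splits)
    show ?case
    proof (rule var_mult.prems[of "map (\<lambda>(c, m). (c, m + Poly_Mapping.single i 1)) ms"], safe)
      fix x
      have "x i * (\<Sum>(c, m)\<leftarrow>ns. c * monomial_eval m x) =
          (\<Sum>(c, m)\<leftarrow>map (\<lambda>(c, m). (c, m + Poly_Mapping.single i 1)) ns. c * monomial_eval m x)"
        for ns
        by (induction ns) (auto simp: monomial_eval_var_mult[unfolded One_nat_def] algebra_simps)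
      thus "x i * f x = (\<Sum>(c, m)\<leftarrow>map (\<lambda>(c, m). (c, m + Poly_Mapping.single i 1)) ms.
              c * monomial_eval m x)"
        unfolding ms[THEN conjunct2, rule_format] .
    next
      fix c m j
      assume "(c, m) \<in> set (map (\<lambda>(c, m). (c, m + Poly_Mapping.single i 1)) ms)"
        and "j \<in> Poly_Mapping.keys m"
      then obtain m' where "(c, m') \<in> set ms" "m = m' + Poly_Mapping.single i 1" by auto
      with ms keys[of m'] \<open>j \<in> _\<close> show "j \<in> V" by blast
    qed
  qed
  moreover have "cmpoly_vars (\<Sum>(c, m)\<leftarrow>ms. Poly_Mapping.single m c) \<subseteq> V \<and>
      cmpoly_eval (\<Sum>(c, m)\<leftarrow>ms. Poly_Mapping.single m c) =
        (\<lambda>x. \<Sum>(c, m)\<leftarrow>ms. c * monomial_eval m x)"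
    if "\<forall>(c, m)\<in>set ms. Poly_Mapping.keys m \<subseteq> V" for ms :: "(complex \<times> (nat \<Rightarrow>\<^sub>0 nat)) list"
    using that
  proof (induction ms)
    case Nil
    show ?case by (auto simp: cmpoly_vars_def cmpoly_eval_def)
  next
    case (Cons a ms)
    obtain c m where a: "a = (c, m)" by force
    have "cmpoly_vars (Poly_Mapping.single m c + (\<Sum>(c, m)\<leftarrow>ms. Poly_Mapping.single m c)) \<subseteq>
        Poly_Mapping.keys m \<union> cmpoly_vars (\<Sum>(c, m)\<leftarrow>ms. Poly_Mapping.single m c)"
      using Poly_Mapping.keys_add[of "Poly_Mapping.single m c" "\<Sum>(c, m)\<leftarrow>ms. Poly_Mapping.single m c"]
      by (auto simp: cmpoly_vars_def split: if_splits)
    with Cons show ?case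
      by (auto simp: a cmpoly_eval_add cmpoly_eval_single)
  qed
  ultimately show ?thesis using that by (metis (no_types, lifting) ext)
qed

subsection \<open>Algebraic elements over a differential field of germs\<close>

definition algebraic_germ :: "(complex \<Rightarrow> complex) set \<Rightarrow> (complex \<Rightarrow> complex) \<Rightarrow> bool" where
  "algebraic_germ G y \<longleftrightarrow> (\<exists>d a. (\<forall>k. a k \<in> germ_field G) \<and>
     (\<forall>\<^sub>F t in at_left_infinity. a d t \<noteq> 0) \<and>
     (\<forall>\<^sub>F t in at_left_infinity. (\<Sum>k\<le>d. a k t * y t ^ k) = 0))"

text \<open>For a relation of minimal degree \<open>d\<close>, its formal derivative
  \<open>E\<close> at \<open>y\<close> has degree \<open>d - 1\<close> and leading coefficient
  \<open>d * a d\<close>, so \<open>E = 0\<close> would be a shorter relation. Differentiating the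
  relation in \<open>t\<close> gives \<open>R + E * y' = 0\<close>, which is solved for
  \<open>y'\<close>.\<close>

lemma algebraic_germ_deriv:
  assumes alg: "algebraic_germ G y"
    and mer: "\<And>g. g \<in> insert y G \<Longrightarrow> meromorphic_in_exp g"
    and der: "\<And>g. g \<in> G \<Longrightarrow> deriv g \<in> germ_field H"
    and GH: "insert y G \<subseteq> germ_field H"
  shows "deriv y \<in> germ_field H"
proof -
  define rel where "rel d a \<longleftrightarrow> (\<forall>k. a k \<in> germ_field G) \<and>
     (\<forall>\<^sub>F t in at_left_infinity. a d t \<noteq> 0) \<and>
     (\<forall>\<^sub>F t in at_left_infinity. (\<Sum>k\<le>d. a k t * y t ^ k) = 0)"
    for d :: nat and a :: "nat \<Rightarrow> complex \<Rightarrow> complex"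
  define d where "d = (LEAST d. \<exists>a. rel d a)"
  have ex: "\<exists>d a. rel d a" using alg by (simp add: algebraic_germ_def rel_def)
  hence "\<exists>a. rel d a" unfolding d_def by (rule LeastI_ex)
  then obtain a where a: "rel d a" by blast
  have least: "\<not> rel e b" if "e < d" for e b
    using not_less_Least[of e "\<lambda>d. \<exists>a. rel d a"] that by (auto simp: d_def)
  have aG: "a k \<in> germ_field G" for k using a by (simp add: rel_def)
  have "d \<noteq> 0"
  proof
    assume "d = 0"
    with a have "\<forall>\<^sub>F t in at_left_infinity. a 0 t \<noteq> 0" "\<forall>\<^sub>F t in at_left_infinity. a 0 t = 0"
      by (simp_all add: rel_def)
    hence "\<forall>\<^sub>F t in at_left_infinity. False" by eventually_elim simp
    thus False by simp
  qed
  then obtain e where e: "d = Suc e" by (cases d) auto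
  define b where "b k = (\<lambda>t. of_nat (Suc k) * a (Suc k) t)" for k
  define E where "E = (\<lambda>t. \<Sum>k\<le>e. b k t * y t ^ k)"
  have bG: "b k \<in> germ_field G" for k
    unfolding b_def by (intro germ_field.mult germ_field.const aG)
  have merG: "meromorphic_in_exp f" if "f \<in> germ_field G" for f
    using that mer by (auto intro: germ_field_meromorphic)
  have yH: "y \<in> germ_field H" using GH by simp
  have GH': "germ_field G \<subseteq> germ_field H" using GH by (intro germ_field_least) auto
  have mer_y: "meromorphic_in_exp y" using mer by simp
  have E_mem: "E \<in> germ_field (insert y G)"
    unfolding E_def using bG germ_field_mono[of G "insert y G"]
    by (intro germ_field_sum germ_field.mult germ_field_power) (auto intro: germ_field.gen)
  have "\<not> (\<forall>\<^sub>F t in at_left_infinity. E t = 0)"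
  proof
    assume "\<forall>\<^sub>F t in at_left_infinity. E t = 0"
    moreover have "\<forall>\<^sub>F t in at_left_infinity. b e t \<noteq> 0"
      using a by (auto simp: rel_def e b_def simp del: of_nat_Suc elim!: eventually_mono)
    ultimately have "rel e b" using bG by (simp add: rel_def E_def)
    with least[of e] e show False by auto
  qed
  hence E_nz: "\<forall>\<^sub>F t in at_left_infinity. E t \<noteq> 0"
    using meromorphic_in_exp_dichotomy[OF germ_field_meromorphic[OF E_mem mer]] by blast
  define R where "R = (\<lambda>t. \<Sum>k\<le>d. deriv (a k) t * y t ^ k)"
  have "\<forall>\<^sub>F t in at_left_infinity. (\<Sum>k\<le>d. a k t * y t ^ k) = 0"
    using a by (simp add: rel_def)
  from eventually_deriv_cong[OF this]
  have zero: "\<forall>\<^sub>F t in at_left_infinity. deriv (\<lambda>t. \<Sum>k\<le>d. a k t * y t ^ k) t = 0"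
    by eventually_elim simp
  have "\<forall>\<^sub>F t in at_left_infinity. \<forall>k\<in>{..d}. (a k has_field_derivative deriv (a k) t) (at t)"
    by (rule eventually_ball_finite) (auto intro: meromorphic_in_exp_deriv(2) merG aG)
  with meromorphic_in_exp_deriv(2)[OF mer_y] zero E_nz
  have "\<forall>\<^sub>F t in at_left_infinity. - R t / E t = deriv y t"
  proof eventually_elim
    case (elim t)
    have "((\<lambda>t. \<Sum>k\<le>d. a k t * y t ^ k) has_field_derivative
        (\<Sum>k\<le>d. deriv (a k) t * y t ^ k + a k t * (of_nat k * y t ^ (k - 1) * deriv y t))) (at t)"
      using elim by (intro DERIV_sum) (auto intro!: derivative_eq_intros)
    from DERIV_imp_deriv[OF this] elim(2)
    have "(\<Sum>k\<le>d. deriv (a k) t * y t ^ k + a k t * (of_nat k * y t ^ (k - 1) * deriv y t)) = 0"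
      by (rule trans[OF sym])
    hence "R t + (\<Sum>k\<le>d. a k t * (of_nat k * y t ^ (k - 1) * deriv y t)) = 0"
      by (simp add: R_def sum.distrib)
    also have "(\<Sum>k\<le>d. a k t * (of_nat k * y t ^ (k - 1) * deriv y t)) = E t * deriv y t"
      unfolding e sum.atMost_Suc_shift E_def sum_distrib_right
      by (simp add: b_def mult_ac)
    finally have "- R t = E t * deriv y t" by (rule minus_unique)
    thus ?case using elim(3) by simp
  qed
  moreover have "deriv (a k) \<in> germ_field H" for k
    using aG mer der GH by (intro germ_field_deriv[of "a k" G H]) auto
  hence "R \<in> germ_field H"
    unfolding R_def by (intro germ_field_sum germ_field.mult germ_field_power yH)
  moreover have "E \<in> germ_field H"
    unfolding E_def using bG GH' by (intro germ_field_sum germ_field.mult germ_field_power yH) auto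
  ultimately show ?thesis
    by - (rule germ_field.cong[where f = "\<lambda>t. - R t / E t"], (intro germ_field_divide germ_field_uminus | assumption)+)
qed

text \<open>The point \<xi> certifies that \<open>P\<close> is not the zero polynomial. Expand in
  the last variable: if every coefficient vanishes on the germs, recurse on one that is nonzero at
  \<xi>; otherwise cut the sum off at the largest index whose coefficient is a nonzero germ.\<close>

lemma vanishing_polyfun_imp_algebraic:
  assumes "P \<in> polyfun {..<M}" "P \<xi> \<noteq> 0"
    and "\<forall>\<^sub>F t in at_left_infinity. P (\<lambda>i. x i t) = 0"
    and mer: "\<And>i. meromorphic_in_exp (x i)"
  shows "\<exists>m<M. algebraic_germ (x ` {..<m}) (x m)"
  using assms(1-3)
proof (induction M arbitrary: P)
  case 0
  then obtain c where c: "P = (\<lambda>_. c)" using polyfun_empty[of P] by auto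
  from 0(3) have "\<forall>\<^sub>F t in at_left_infinity. False"
    by eventually_elim (use 0(2) c in simp)
  thus ?case by simp
next
  case (Suc M)
  have "P \<in> polyfun (insert M {..<M})" using Suc.prems(1) by (simp add: lessThan_Suc)
  from polyfun_coeffs[OF this] obtain d a where a: "\<And>k. a k \<in> polyfun {..<M}"
      "\<And>x. P x = (\<Sum>k\<le>d. a k x * x M ^ k)" by blast
  define c where "c k = (\<lambda>t. a k (\<lambda>i. x i t))" for k
  have c: "c k \<in> germ_field (x ` {..<M})" for k
    unfolding c_def using a(1) by (rule polyfun_germ_field)
  hence dich: "(\<forall>\<^sub>F t in at_left_infinity. c k t = 0) \<or> (\<forall>\<^sub>F t in at_left_infinity. c k t \<noteq> 0)" for k
    using mer by (intro meromorphic_in_exp_dichotomy germ_field_meromorphic[of "c k" "x ` {..<M}"]) auto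
  have rel: "\<forall>\<^sub>F t in at_left_infinity. (\<Sum>k\<le>d. c k t * x M t ^ k) = 0"
    using Suc.prems(3) unfolding a(2) c_def .
  show ?case
  proof (cases "\<forall>k\<le>d. \<forall>\<^sub>F t in at_left_infinity. c k t = 0")
    case True
    from Suc.prems(2) obtain k where k: "k \<le> d" "a k \<xi> \<noteq> 0"
      unfolding a(2) by (metis (no_types, lifting) atMost_iff mult_eq_0_iff sum.neutral)
    from Suc.IH[OF a(1) k(2)] True k(1) show ?thesis by (auto simp: c_def less_Suc_eq)
  next
    case False
    define D where "D = Max {k. k \<le> d \<and> \<not> (\<forall>\<^sub>F t in at_left_infinity. c k t = 0)}"
    have D: "D \<in> {k. k \<le> d \<and> \<not> (\<forall>\<^sub>F t in at_left_infinity. c k t = 0)}"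
      unfolding D_def using False by (intro Max_in) auto
    have above: "\<forall>\<^sub>F t in at_left_infinity. c k t = 0" if "k \<in> {D<..d}" for k
      using that Max_ge[of "{k. k \<le> d \<and> \<not> (\<forall>\<^sub>F t in at_left_infinity. c k t = 0)}" k]
      by (fastforce simp: D_def[symmetric])
    have "\<forall>\<^sub>F t in at_left_infinity. \<forall>k\<in>{D<..d}. c k t = 0"
      by (rule eventually_ball_finite) (use above in auto)
    with rel have "\<forall>\<^sub>F t in at_left_infinity. (\<Sum>k\<le>D. c k t * x M t ^ k) = 0"
    proof eventually_elim
      case (elim t)
      have "(\<Sum>k\<le>D. c k t * x M t ^ k) = (\<Sum>k\<le>d. c k t * x M t ^ k)"
        using D elim by (intro sum.mono_neutral_left) auto
      thus ?case using elim by simp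
    qed
    moreover have "\<forall>\<^sub>F t in at_left_infinity. c D t \<noteq> 0" using D dich by blast
    ultimately have "algebraic_germ (x ` {..<M}) (x M)"
      unfolding algebraic_germ_def using c by blast
    thus ?thesis by blast
  qed
qed

subsection \<open>The hypergeometric power series\<close>

definition mirror_coeff :: "nat \<Rightarrow> nat \<Rightarrow> complex" where
  "mirror_coeff s l = fact (s * l) / fact l ^ s"

definition mirror_harm :: "nat \<Rightarrow> nat \<Rightarrow> complex" where
  "mirror_harm s l = (\<Sum>k = l + 1..s * l. 1 / of_nat k)"

text \<open>With \<delta> for the variable, this is the operator
  \<open>s (s \<delta> + 1) ... (s \<delta> + s - 1)\<close> multiplied by \<open>z\<close> in the
  differential equation.\<close>

definition mirror_poly :: "nat \<Rightarrow> complex poly" where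
  "mirror_poly s = Polynomial.smult (of_nat s) (\<Prod>i = 1..<s. [:of_nat i, of_nat s:])"

lemma degree_mirror_poly: "s \<ge> 1 \<Longrightarrow> degree (mirror_poly s) = s - 1"
  by (simp add: mirror_poly_def degree_prod_eq_sum_degree)

lemma lead_coeff_mirror_poly:
  assumes "s \<ge> 1"
  shows "coeff (mirror_poly s) (s - 1) = of_nat s ^ s"
proof -
  have "lead_coeff (mirror_poly s) = of_nat s * of_nat s ^ (s - 1)"
    using assms by (simp add: mirror_poly_def lead_coeff_smult lead_coeff_prod)
  also have "\<dots> = of_nat s ^ s"
    using assms by (simp flip: power_Suc)
  finally show ?thesis using assms by (simp add: degree_mirror_poly)
qed

text \<open>Of the \<open>s\<close> new factors in \<open>fact (s * Suc l)\<close>, the last is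
  \<open>s * Suc l\<close>. It cancels one of the \<open>s\<close> powers of \<open>Suc l\<close>
  and leaves the factor \<open>s\<close> of \<open>mirror_poly\<close>.\<close>

lemma mirror_coeff_Suc:
  assumes "s \<ge> 1"
  shows "of_nat (Suc l) ^ (s - 1) * mirror_coeff s (Suc l) =
           poly (mirror_poly s) (of_nat l) * mirror_coeff s l"
proof -
  have "fact (m + j) = fact m * (\<Prod>i=1..<Suc j. of_nat (m + i) :: complex)" for m j
    by (induction j) (simp_all add: algebra_simps)
  from this[of "s * l" s] have "fact (s * Suc l) = fact (s * l) * (\<Prod>i=1..<Suc s. of_nat (s * l + i) :: complex)"
    by (simp add: algebra_simps)
  also have "(\<Prod>i=1..<Suc s. of_nat (s * l + i) :: complex) =
      (\<Prod>i=1..<s. of_nat (s * l + i)) * of_nat s * of_nat (Suc l)"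
    using assms by (simp add: algebra_simps)
  also have "(\<Prod>i=1..<s. of_nat (s * l + i) :: complex) * of_nat s = poly (mirror_poly s) (of_nat l)"
    by (simp add: mirror_poly_def poly_prod algebra_simps)
  finally have 1: "fact (s * Suc l) =
      fact (s * l) * (poly (mirror_poly s) (of_nat l) * (of_nat (Suc l) :: complex))" .
  have 2: "fact (Suc l) ^ s = (of_nat (Suc l) ^ (s - 1) * of_nat (Suc l) * fact l ^ s :: complex)"
    using assms by (simp add: power_mult_distrib flip: power_Suc2 del: of_nat_Suc)
  show ?thesis
    unfolding mirror_coeff_def 1 2 by (simp del: of_nat_Suc add: divide_simps)
qed

text \<open>If factorials are interpolated by the Gamma function, \<open>s * mirror_harm s l\<close>
  is the derivative of log \<open>mirror_coeff\<close> in \<open>l\<close>. The claim is the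
  logarithmic derivative of the recursion for \<open>mirror_coeff\<close>.\<close>

lemma mirror_harm_Suc:
  assumes "s \<ge> 1"
  shows "of_nat s * (mirror_harm s (Suc l) - mirror_harm s l) + of_nat (s - 1) / of_nat (Suc l) =
           of_nat s * (\<Sum>i = 1..<s. 1 / of_nat (s * l + i))"
proof -
  define h where "h n = (\<Sum>k = 1..n. 1 / of_nat k :: complex)" for n :: nat
  have "mirror_harm s l = h (s * l) - h l" for l
  proof -
    have "{1..m} = {1..l} \<union> {l + 1..m}" if "l \<le> m" for m using that by auto
    from this[of "s * l"] have "{1..s * l} = {1..l} \<union> {l + 1..s * l}"
      using mult_le_mono1[OF assms, of l] by simp
    hence "h (s * l) = h l + mirror_harm s l"
      unfolding h_def mirror_harm_def by (simp add: sum.union_disjoint)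
    thus ?thesis by simp
  qed
  moreover have "h (m + j) = h m + (\<Sum>i=1..<Suc j. 1 / of_nat (m + i))" for m j
    by (induction j) (simp_all add: h_def)
  from this[of "s * l" s] have "h (s * Suc l) = h (s * l) + (\<Sum>i=1..<s. 1 / of_nat (s * l + i))
      + 1 / (of_nat s * of_nat (Suc l))"
    using assms by (simp add: algebra_simps)
  moreover have "h (Suc l) = h l + 1 / of_nat (Suc l)"
    by (simp add: h_def)
  moreover have "n * ((B + S + 1 / (n * N) - (D + 1 / N)) - (B - D)) + (n - 1) / N = n * S"
    if "n \<noteq> 0" "N \<noteq> 0" for n N B D S :: complex
    using that by (simp add: field_simps)
  ultimately show ?thesis
    using assms by (simp only: of_nat_diff of_nat_1 of_nat_eq_0_iff)
qed

lemma poly_pderiv_mirror_poly: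
  assumes "s \<ge> 1"
  shows "poly (pderiv (mirror_poly s)) (of_nat l) =
           poly (mirror_poly s) (of_nat l) * (of_nat s * (\<Sum>i = 1..<s. 1 / of_nat (s * l + i)))"
proof -
  define f where "f i = (of_nat (s * l + i) :: complex)" for i
  have f: "f i \<noteq> 0" if "i \<in> {1..<s}" for i
    using that unfolding f_def of_nat_eq_0_iff by simp
  have "(\<Prod>j\<in>{1..<s} - {i}. f j) = (\<Prod>j=1..<s. f j) * (1 / f i)" if "i \<in> {1..<s}" for i
    using f[OF that] prod.remove[OF _ that, of f] by simp
  hence "(\<Sum>i=1..<s. (\<Prod>j\<in>{1..<s} - {i}. f j) * of_nat s) =
      (\<Prod>j=1..<s. f j) * (of_nat s * (\<Sum>i=1..<s. 1 / f i))"
    by (simp add: sum_distrib_left mult_ac)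
  thus ?thesis
    by (simp add: mirror_poly_def pderiv_smult pderiv_prod poly_sum poly_prod pderiv_pCons f_def
        algebra_simps)
qed

text \<open>Frobenius method: \<open>b\<close> is the derivative of \<open>mirror_coeff\<close> in
  \<open>l\<close>, and the claim is the derivative of its recursion. It is obtained by multiplying
  the recursion by the equality of the logarithmic derivatives of both sides.\<close>

lemma mirror_log_coeff_Suc:
  assumes "s \<ge> 2"
  defines "b \<equiv> \<lambda>l. of_nat s * (mirror_coeff s l * mirror_harm s l)"
  shows "of_nat (Suc l) ^ (s - 1) * b (Suc l) +
           of_nat (s - 1) * of_nat (Suc l) ^ (s - 2) * mirror_coeff s (Suc l) =
         poly (mirror_poly s) (of_nat l) * b l +
           poly (pderiv (mirror_poly s)) (of_nat l) * mirror_coeff s l"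
proof -
  define Q where "Q = poly (mirror_poly s) (of_nat l)"
  have "s \<ge> 1" using assms(1) by simp
  have pow: "of_nat (Suc l) ^ (s - 2) = (of_nat (Suc l) ^ (s - 1) / of_nat (Suc l) :: complex)"
    using assms(1) by (simp add: field_simps flip: power_Suc power_Suc2 del: of_nat_Suc)
       (simp add: Suc_diff_Suc numeral_2_eq_2)
  have harm: "of_nat s * mirror_harm s (Suc l) + of_nat (s - 1) / of_nat (Suc l) =
      of_nat s * mirror_harm s l + of_nat s * (\<Sum>i = 1..<s. 1 / of_nat (s * l + i))"
  proof -
    have "x + v = y + w" if "x - y + v = w" for x y v w :: complex
      using that by (simp add: algebra_simps)
    from this[OF mirror_harm_Suc[OF \<open>s \<ge> 1\<close>, of l, unfolded right_diff_distrib]]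
    show ?thesis .
  qed
  have "of_nat (Suc l) ^ (s - 1) * b (Suc l) +
           of_nat (s - 1) * of_nat (Suc l) ^ (s - 2) * mirror_coeff s (Suc l) =
      (of_nat (Suc l) ^ (s - 1) * mirror_coeff s (Suc l)) *
        (of_nat s * mirror_harm s (Suc l) + of_nat (s - 1) / of_nat (Suc l))"
    unfolding b_def pow by (simp add: algebra_simps del: of_nat_Suc)
  also have "\<dots> = Q * mirror_coeff s l *
      (of_nat s * mirror_harm s l + of_nat s * (\<Sum>i = 1..<s. 1 / of_nat (s * l + i)))"
    unfolding mirror_coeff_Suc[OF \<open>s \<ge> 1\<close>] harm Q_def ..
  also have "\<dots> = Q * b l + poly (pderiv (mirror_poly s)) (of_nat l) * mirror_coeff s l"
    unfolding poly_pderiv_mirror_poly[OF \<open>s \<ge> 1\<close>] Q_def[symmetric] b_def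
    by (simp add: algebra_simps)
  finally show ?thesis unfolding Q_def .
qed

section \<open>The Euler operator on power series: recursions become differential equations\<close>

definition fps_theta :: "complex fps \<Rightarrow> complex fps" where
  "fps_theta F = fps_X * fps_deriv F"

lemma fps_nth_theta_power: "fps_nth ((fps_theta ^^ k) F) l = of_nat l ^ k * fps_nth F l"
  by (induction k) (simp_all add: fps_theta_def mult_ac)

lemma fps_conv_radius_theta_power: "fps_conv_radius ((fps_theta ^^ k) F) \<ge> fps_conv_radius F"
proof (induction k)
  case (Suc k)
  have "fps_conv_radius H \<le> fps_conv_radius (fps_theta H)" for H
    unfolding fps_theta_def
    using fps_conv_radius_mult[of fps_X "fps_deriv H"] fps_conv_radius_deriv[of H] by auto
  from order_trans[OF Suc this] show ?case by simp
qed simp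

definition mirror_fps :: "nat \<Rightarrow> complex fps" where
  "mirror_fps s = Abs_fps (mirror_coeff s)"

definition mirror_log_fps :: "nat \<Rightarrow> complex fps" where
  "mirror_log_fps s = Abs_fps (\<lambda>l. of_nat s * (mirror_coeff s l * mirror_harm s l))"

lemma fps_nth_X_mult_sum:
  "fps_nth (fps_X * (\<Sum>i\<le>d. fps_const (c i) * F i)) l =
     (if l = 0 then 0 else (\<Sum>i\<le>d. c i * fps_nth (F i) (l - 1)))"
  for c :: "nat \<Rightarrow> complex"
  by (simp add: fps_sum_nth)

lemma mirror_fps_ode:
  assumes "s \<ge> 2"
  shows "(fps_theta ^^ (s - 1)) (mirror_fps s) =
    fps_X * (\<Sum>i\<le>s - 1. fps_const (coeff (mirror_poly s) i) * (fps_theta ^^ i) (mirror_fps s))"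
proof (rule fps_ext)
  fix l
  show "fps_nth ((fps_theta ^^ (s - 1)) (mirror_fps s)) l =
    fps_nth (fps_X * (\<Sum>i\<le>s - 1. fps_const (coeff (mirror_poly s) i) * (fps_theta ^^ i) (mirror_fps s))) l"
  proof (cases l)
    case 0
    thus ?thesis using assms by (simp add: fps_nth_theta_power)
  next
    case (Suc m)
    thus ?thesis
      using mirror_coeff_Suc[of s m] assms
      unfolding fps_nth_X_mult_sum fps_nth_theta_power mirror_fps_def poly_altdef
      by (simp add: degree_mirror_poly sum_distrib_left mult_ac)
  qed
qed

lemma poly_pderiv_altdef:
  fixes p :: "complex poly"
  assumes "degree p \<le> d"
  shows "poly (pderiv p) x = (\<Sum>i\<le>d. coeff p i * (of_nat i * x ^ (i - 1)))"
proof -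
  have "poly p y = (\<Sum>i\<le>d. coeff p i * y ^ i)" for y
    unfolding poly_altdef using assms
    by (intro sum.mono_neutral_left) (auto simp: coeff_eq_0)
  hence "poly p = (\<lambda>y. \<Sum>i\<le>d. coeff p i * y ^ i)" by auto
  moreover have "((\<lambda>y. \<Sum>i\<le>d. coeff p i * y ^ i) has_field_derivative
      (\<Sum>i\<le>d. coeff p i * (of_nat i * x ^ (i - 1)))) (at x)"
    by (intro DERIV_sum) (auto intro!: derivative_eq_intros)
  ultimately show ?thesis using DERIV_unique[OF poly_DERIV[of p x]] by simp
qed

text \<open>The logarithmic solution \<open>f\<^sub>0 log z + g\<^sub>1\<close> enters as the formal derivative
  of the operator with respect to \<open>\<delta>\<close>, applied to \<open>f\<^sub>0\<close>.\<close>

lemma mirror_log_fps_ode: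
  assumes "s \<ge> 3"
  defines "F \<equiv> mirror_fps s" and "G \<equiv> mirror_log_fps s"
  shows "(fps_theta ^^ (s - 1)) G + fps_const (of_nat (s - 1)) * (fps_theta ^^ (s - 2)) F =
    fps_X * (\<Sum>i\<le>s - 1. fps_const (coeff (mirror_poly s) i) *
      ((fps_theta ^^ i) G + fps_const (of_nat i) * (fps_theta ^^ (i - 1)) F))"
proof (rule fps_ext)
  fix l
  show "fps_nth ((fps_theta ^^ (s - 1)) G + fps_const (of_nat (s - 1)) * (fps_theta ^^ (s - 2)) F) l =
    fps_nth (fps_X * (\<Sum>i\<le>s - 1. fps_const (coeff (mirror_poly s) i) *
      ((fps_theta ^^ i) G + fps_const (of_nat i) * (fps_theta ^^ (i - 1)) F))) l"
  proof (cases l)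
    case 0
    \<comment> \<open>Here \<open>s \<ge> 3\<close> matters: for \<open>s = 2\<close> the term of
      order \<open>s - 2\<close> would contribute 1 to the constant coefficient.\<close>
    thus ?thesis using assms(1) by (simp add: fps_nth_theta_power power_0_left)
  next
    case (Suc m)
    define b where "b l = of_nat s * (mirror_coeff s l * mirror_harm s l)" for l
    have nth: "fps_nth F = mirror_coeff s" "fps_nth G = b"
      by (auto simp: fun_eq_iff F_def G_def b_def mirror_fps_def mirror_log_fps_def)
    have "poly (mirror_poly s) (of_nat m) = (\<Sum>i\<le>s - 1. coeff (mirror_poly s) i * of_nat m ^ i)"
      using assms(1) by (simp add: poly_altdef degree_mirror_poly)
    moreover have "poly (pderiv (mirror_poly s)) (of_nat m) =
        (\<Sum>i\<le>s - 1. coeff (mirror_poly s) i * (of_nat i * of_nat m ^ (i - 1)))"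
      using assms(1) by (intro poly_pderiv_altdef) (simp add: degree_mirror_poly)
    ultimately show ?thesis
      using mirror_log_coeff_Suc[of s m, folded b_def] assms(1)
      unfolding fps_nth_X_mult_sum Suc
      by (simp add: nth fps_nth_theta_power sum_distrib_left sum.distrib distrib_left mult_ac
           flip: of_nat_Suc del: of_nat_Suc)
  qed
qed

section \<open>Convergence and evaluation of the two series\<close>

lemma fps_conv_radius_ge:
  assumes "\<And>l. norm (fps_nth F l) \<le> C * K ^ l" "K > 0"
  shows "fps_conv_radius F \<ge> ereal (1 / K)"
  unfolding fps_conv_radius_def
proof (rule conv_radius_geI_ex')
  fix r :: real assume r: "0 < r" "ereal r < ereal (1 / K)"
  hence Kr: "K * r < 1" using assms(2) by (simp add: field_simps)
  show "summable (\<lambda>n. fps_nth F n * of_real r ^ n)"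
  proof (rule summable_comparison_test')
    show "summable (\<lambda>l. C * (K * r) ^ l)"
      using Kr r assms(2) by (intro summable_mult summable_geometric) simp
    show "norm (fps_nth F l * of_real r ^ l) \<le> C * (K * r) ^ l" for l
      using mult_right_mono[OF assms(1)[of l], of "r ^ l"] r(1)
      by (simp add: norm_mult norm_power power_mult_distrib mult_ac)
  qed
qed

lemma mirror_conv_radius:
  assumes "s \<ge> 1"
  obtains R where "R > 0" "fps_conv_radius (mirror_fps s) \<ge> ereal R"
    "fps_conv_radius (mirror_log_fps s) \<ge> ereal R"
proof
  \<comment> \<open>The factor 2 absorbs the harmonic sums, which are at most \<open>s * l\<close>
    and hence at most \<open>s * 2 ^ l\<close>.\<close>
  define K where "K = 2 * real (s ^ s)"
  have K: "K > 0" using assms by (simp add: K_def)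
  thus "1 / K > 0" by simp
  have c: "norm (mirror_coeff s l) \<le> real (s ^ s) ^ l" for l
    using mirror_coeff_bound[of s l] by (simp add: mirror_coeff_def norm_divide norm_power)
  show "fps_conv_radius (mirror_fps s) \<ge> ereal (1 / K)"
  proof (rule fps_conv_radius_ge[where C = 1, OF _ K])
    fix l
    have "real (s ^ s) ^ l \<le> K ^ l" by (rule power_mono) (simp_all add: K_def)
    thus "norm (fps_nth (mirror_fps s) l) \<le> 1 * K ^ l" using c[of l] by (simp add: mirror_fps_def)
  qed
  show "fps_conv_radius (mirror_log_fps s) \<ge> ereal (1 / K)"
  proof (rule fps_conv_radius_ge[where C = "real s * real s", OF _ K])
    fix l
    have "norm (mirror_harm s l) \<le> (\<Sum>k = l + 1..s * l. 1)"
      unfolding mirror_harm_def by (rule sum_norm_le) (simp add: norm_divide)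
    also have "\<dots> = real (s * l - l)" by simp
    also have "\<dots> \<le> real (s * l)" by (rule of_nat_mono) simp
    also have "\<dots> \<le> real s * 2 ^ l"
      unfolding of_nat_mult by (intro mult_left_mono less_imp_le[OF of_nat_less_two_power]) simp
    finally have "norm (mirror_coeff s l * mirror_harm s l) \<le> real (s ^ s) ^ l * (real s * 2 ^ l)"
      unfolding norm_mult using c by (intro mult_mono) auto
    hence "real s * norm (mirror_coeff s l * mirror_harm s l) \<le>
        real s * (real (s ^ s) ^ l * (real s * 2 ^ l))"
      by (rule mult_left_mono) simp
    thus "norm (fps_nth (mirror_log_fps s) l) \<le> real s * real s * K ^ l"
      by (simp add: mirror_log_fps_def K_def norm_mult power_mult_distrib mult_ac)
  qed
qed

lemma f0_eq_eval_fps: "f0 s z = eval_fps (mirror_fps s) z"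
  by (simp add: f0_def eval_fps_def mirror_fps_def mirror_coeff_def)

text \<open>\<open>g1\<close> has the factor \<open>s\<close> outside the sum, the series has it in
  every coefficient. Moving it needs summability, whence the bound on \<open>z\<close>; for
  \<open>s = 0\<close> both sides are 0.\<close>

lemma g1_eq_eval_fps:
  assumes "ereal (norm z) < fps_conv_radius (mirror_log_fps s)"
  shows "g1 s z = eval_fps (mirror_log_fps s) z"
proof (cases "s = 0")
  case False
  have "summable (\<lambda>l. fps_nth (mirror_log_fps s) l * z ^ l)"
    using assms unfolding fps_conv_radius_def by (rule summable_in_conv_radius)
  hence "summable (\<lambda>l. inverse (of_nat s) * (fps_nth (mirror_log_fps s) l * z ^ l))"
    by (rule summable_mult)
  hence "summable (\<lambda>l. mirror_coeff s l * mirror_harm s l * z ^ l)"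
    using False by (simp add: mirror_log_fps_def field_simps)
  from suminf_mult[OF this, of "of_nat s"] show ?thesis
    by (simp add: g1_def eval_fps_def mirror_log_fps_def mirror_coeff_def mirror_harm_def mult_ac)
qed (simp add: g1_def eval_fps_def mirror_log_fps_def)

lemma fps_conv_radius_sum_ge:
  "(\<And>i. i \<in> A \<Longrightarrow> fps_conv_radius (F i) \<ge> R) \<Longrightarrow> fps_conv_radius (\<Sum>i\<in>A. F i) \<ge> R"
  for F :: "'i \<Rightarrow> complex fps"
proof (induction A rule: infinite_finite_induct)
  case (insert i A)
  thus ?case using fps_conv_radius_add[of "F i" "\<Sum>i\<in>A. F i"]
    by (auto intro: order_trans[rotated])
qed auto

lemma eval_fps_sum:
  fixes F :: "'i \<Rightarrow> complex fps"
  assumes "\<And>i. i \<in> A \<Longrightarrow> fps_conv_radius (F i) \<ge> R" "ereal (norm z) < R"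
  shows "eval_fps (\<Sum>i\<in>A. F i) z = (\<Sum>i\<in>A. eval_fps (F i) z)"
  using assms(1)
proof (induction A rule: infinite_finite_induct)
  case (insert i A)
  have "ereal (norm z) < fps_conv_radius (F i)" using insert.prems assms(2) by force
  moreover have "ereal (norm z) < fps_conv_radius (\<Sum>i\<in>A. F i)"
    using fps_conv_radius_sum_ge[of A R F] insert.prems assms(2) by force
  ultimately show ?case using insert by (simp add: eval_fps_add)
qed auto

lemma has_field_derivative_eval_theta:
  assumes "ereal (norm z) < fps_conv_radius F"
  obtains D where "(eval_fps F has_field_derivative D) (at z)" "z * D = eval_fps (fps_theta F) z"
proof
  show "(eval_fps F has_field_derivative eval_fps (fps_deriv F) z) (at z)"
    using assms by (intro has_field_derivative_eval_fps) auto
  have "ereal (norm z) < fps_conv_radius (fps_deriv F)"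
    using assms fps_conv_radius_deriv[of F] by (rule less_le_trans)
  thus "z * eval_fps (fps_deriv F) z = eval_fps (fps_theta F) z"
    by (simp add: fps_theta_def eval_fps_mult)
qed

lemma mirror_ode:
  assumes "s \<ge> 3" and F: "ereal (norm z) < fps_conv_radius (mirror_fps s)"
    and G: "ereal (norm z) < fps_conv_radius (mirror_log_fps s)"
  defines "U \<equiv> \<lambda>k. eval_fps ((fps_theta ^^ k) (mirror_fps s)) z"
    and "W \<equiv> \<lambda>k. eval_fps ((fps_theta ^^ k) (mirror_log_fps s)) z"
  shows "U (s - 1) = z * (\<Sum>i\<le>s - 1. coeff (mirror_poly s) i * U i)"
    and "W (s - 1) + of_nat (s - 1) * U (s - 2) =
           z * (\<Sum>i\<le>s - 1. coeff (mirror_poly s) i * (W i + of_nat i * U (i - 1)))"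
proof -
  define R where "R = min (fps_conv_radius (mirror_fps s)) (fps_conv_radius (mirror_log_fps s))"
  have R: "ereal (norm z) < R" using F G by (simp add: R_def)
  \<comment> \<open>On the ring \<open>A\<close> evaluation at \<open>z\<close> is a homomorphism,
    so the formal identities can be evaluated term by term.\<close>
  define A where "A = {f :: complex fps. fps_conv_radius f \<ge> R}"
  have zA: "ereal (norm z) < fps_conv_radius f" if "f \<in> A" for f
    using that R by (auto simp: A_def)
  have FA: "(fps_theta ^^ k) (mirror_fps s) \<in> A" for k
    using fps_conv_radius_theta_power[of "mirror_fps s" k] by (auto simp: A_def R_def min_def)
  have GA: "(fps_theta ^^ k) (mirror_log_fps s) \<in> A" for k
    using fps_conv_radius_theta_power[of "mirror_log_fps s" k] by (auto simp: A_def R_def min_def)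
  have multA: "f * g \<in> A" if "f \<in> A" "g \<in> A" for f g
    using that fps_conv_radius_mult[of f g] by (auto simp: A_def intro: order_trans[rotated])
  have addA: "f + g \<in> A" if "f \<in> A" "g \<in> A" for f g
    using that fps_conv_radius_add[of f g] by (auto simp: A_def intro: order_trans[rotated])
  have constA: "fps_const c \<in> A" "fps_X \<in> A" for c by (auto simp: A_def)
  have sumA: "(\<Sum>i\<in>I. f i) \<in> A" if "\<And>i. i \<in> I \<Longrightarrow> f i \<in> A" for f :: "nat \<Rightarrow> _" and I
    using that fps_conv_radius_sum_ge[of I R f] by (auto simp: A_def)
  have eval_sum: "eval_fps (\<Sum>i\<in>I. f i) z = (\<Sum>i\<in>I. eval_fps (f i) z)"
    if "\<And>i. f i \<in> A" for f :: "nat \<Rightarrow> _" and I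
    using that eval_fps_sum[of I R f z] R by (auto simp: A_def)
  note mem = FA GA multA addA constA sumA
  note ev = eval_sum eval_fps_mult[OF zA zA] eval_fps_add[OF zA zA]
  show "U (s - 1) = z * (\<Sum>i\<le>s - 1. coeff (mirror_poly s) i * U i)"
    using arg_cong[OF mirror_fps_ode[of s], of "\<lambda>f. eval_fps f z"] assms(1)
    by (simp add: U_def ev mem)
  show "W (s - 1) + of_nat (s - 1) * U (s - 2) =
           z * (\<Sum>i\<le>s - 1. coeff (mirror_poly s) i * (W i + of_nat i * U (i - 1)))"
    using arg_cong[OF mirror_log_fps_ode[of s], of "\<lambda>f. eval_fps f z"] assms(1)
    by (simp add: U_def W_def ev mem del: of_nat_diff fps_of_nat)
qed

subsection \<open>Rational functions with poles on the conifold locus\<close>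

text \<open>Reducing the differential equation creates no denominators except powers of
  \<open>1 - S * y\<close>, where \<open>S\<close> will be \<open>s ^ s\<close>. The set is closed
  under differentiation away from the pole.\<close>

inductive_set ratfun :: "complex \<Rightarrow> (complex \<Rightarrow> complex) set" for S where
  const: "(\<lambda>_. c) \<in> ratfun S"
| id: "(\<lambda>y. y) \<in> ratfun S"
| add: "f \<in> ratfun S \<Longrightarrow> g \<in> ratfun S \<Longrightarrow> (\<lambda>y. f y + g y) \<in> ratfun S"
| mult: "f \<in> ratfun S \<Longrightarrow> g \<in> ratfun S \<Longrightarrow> (\<lambda>y. f y * g y) \<in> ratfun S"
| inverse: "(\<lambda>y. inverse (1 - S * y)) \<in> ratfun S"

lemma ratfun_deriv:
  assumes "r \<in> ratfun S"
  shows "\<exists>r'\<in>ratfun S. \<forall>y. 1 - S * y \<noteq> 0 \<longrightarrow> (r has_field_derivative r' y) (at y)"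
  using assms
proof induction
  case (const c)
  show ?case by (rule bexI[of _ "\<lambda>_. 0"]) (auto intro: ratfun.const)
next
  case id
  show ?case by (rule bexI[of _ "\<lambda>_. 1"]) (auto intro: ratfun.const)
next
  case (add f g)
  then obtain f' g' where
    "f' \<in> ratfun S" "\<forall>y. 1 - S * y \<noteq> 0 \<longrightarrow> (f has_field_derivative f' y) (at y)"
    "g' \<in> ratfun S" "\<forall>y. 1 - S * y \<noteq> 0 \<longrightarrow> (g has_field_derivative g' y) (at y)"
    by blast
  thus ?case
    by (intro bexI[of _ "\<lambda>y. f' y + g' y"]) (auto intro: ratfun.add DERIV_add)
next
  case (mult f g)
  then obtain f' g' where
    "f' \<in> ratfun S" "\<forall>y. 1 - S * y \<noteq> 0 \<longrightarrow> (f has_field_derivative f' y) (at y)"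
    "g' \<in> ratfun S" "\<forall>y. 1 - S * y \<noteq> 0 \<longrightarrow> (g has_field_derivative g' y) (at y)"
    by blast
  with mult.hyps show ?case
    by (intro bexI[of _ "\<lambda>y. f' y * g y + g' y * f y"])
       (auto intro: ratfun.add ratfun.mult DERIV_mult)
next
  case inverse
  have "((\<lambda>y. inverse (1 - S * y)) has_field_derivative
      S * (inverse (1 - S * y) * inverse (1 - S * y))) (at y)" if "1 - S * y \<noteq> 0" for y
    using that by (auto intro!: derivative_eq_intros)
  moreover have "(\<lambda>y. S * (inverse (1 - S * y) * inverse (1 - S * y))) \<in> ratfun S"
    by (intro ratfun.const ratfun.mult ratfun.inverse)
  ultimately show ?case
    by (intro bexI[of _ "\<lambda>y. S * (inverse (1 - S * y) * inverse (1 - S * y))"] allI impI)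
qed

text \<open>Here \<open>x 0\<close> stands for \<open>z\<close> and \<open>x j\<close> for \<tau>_j.
  These are expressions in free variables, not germs, so that a determinant can also be evaluated at
  an artificial point.\<close>

inductive_set locfun :: "complex \<Rightarrow> nat set \<Rightarrow> ((nat \<Rightarrow> complex) \<Rightarrow> complex) set" for S V where
  const: "(\<lambda>_. c) \<in> locfun S V"
| var: "i \<in> V \<Longrightarrow> (\<lambda>x. x i) \<in> locfun S V"
| add: "f \<in> locfun S V \<Longrightarrow> g \<in> locfun S V \<Longrightarrow> (\<lambda>x. f x + g x) \<in> locfun S V"
| mult: "f \<in> locfun S V \<Longrightarrow> g \<in> locfun S V \<Longrightarrow> (\<lambda>x. f x * g x) \<in> locfun S V"
| inverse: "(\<lambda>x. inverse (1 - S * x 0)) \<in> locfun S V"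

lemma locfun_diff:
  assumes "f \<in> locfun S V" "g \<in> locfun S V"
  shows "(\<lambda>x. f x - g x) \<in> locfun S V"
  using locfun.add[OF assms(1) locfun.mult[OF locfun.const[of "-1"] assms(2)]] by simp

lemma locfun_sum:
  "(\<And>i. i \<in> I \<Longrightarrow> f i \<in> locfun S V) \<Longrightarrow> (\<lambda>x. \<Sum>i\<in>I. f i x) \<in> locfun S V"
  by (induction I rule: infinite_finite_induct) (auto intro: locfun.const locfun.add)

lemma locfun_prod:
  "(\<And>i. i \<in> I \<Longrightarrow> f i \<in> locfun S V) \<Longrightarrow> (\<lambda>x. \<Prod>i\<in>I. f i x) \<in> locfun S V"
  by (induction I rule: infinite_finite_induct) (auto intro: locfun.const locfun.mult)

lemma locfun_ratfun:
  assumes "r \<in> ratfun S" "0 \<in> V"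
  shows "(\<lambda>x. r (x 0)) \<in> locfun S V"
  using assms(1) by induction (use assms(2) in \<open>auto intro: locfun.intros\<close>)

lemma locfun_det:
  assumes "\<And>k i. k < N \<Longrightarrow> i < N \<Longrightarrow> e k i \<in> locfun S V"
  shows "(\<lambda>x. det (mat N N (\<lambda>(k, i). e k i x))) \<in> locfun S V"
proof -
  have less: "p k < N" if "p permutes {0..<N}" "k < N" for p k
    using permutes_in_image[OF that(1), of k] that(2) by simp
  have eq: "det (mat N N (\<lambda>(k, i). e k i x)) =
      (\<Sum>p | p permutes {0..<N}. signof p * (\<Prod>k = 0..<N. e k (p k) x))" for x
    unfolding det_def'[OF mat_carrier]
    by (intro sum.cong prod.cong arg_cong2[where f = "(*)"] refl)
       (auto simp: less)
  show ?thesis unfolding eq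
    by (intro locfun_sum locfun.mult locfun.const locfun_prod assms) (auto simp: less)
qed

lemma locfun_germ_field:
  assumes "f \<in> locfun S V" "0 \<in> V"
  shows "(\<lambda>t. f (\<lambda>i. x i t)) \<in> germ_field (x ` V)"
  using assms(1)
proof induction
  case inverse
  have "(\<lambda>t. inverse (1 + - (S * x 0 t))) \<in> germ_field (x ` V)"
    using assms(2)
    by (intro germ_field.inverse germ_field.add germ_field_uminus germ_field.mult
          germ_field.const germ_field.gen) auto
  thus ?case by simp
qed (auto intro: germ_field.const germ_field.add germ_field.mult germ_field.gen)

text \<open>Prepares for \<open>vanishing_polyfun_imp_algebraic\<close>, which deals with
  polynomials: one exponent serves for all points off the pole.\<close>

lemma locfun_clear_denominators:
  assumes "f \<in> locfun S V" "0 \<in> V"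
  shows "\<exists>N. \<exists>p\<in>polyfun V. \<forall>x. 1 - S * x 0 \<noteq> 0 \<longrightarrow> f x * (1 - S * x 0) ^ N = p x"
proof -
  have D: "(\<lambda>x. (1 - S * x 0) ^ N) \<in> polyfun V" for N
    by (intro polyfun_power polyfun_diff polyfun_mult polyfun.const polyfun_var assms(2))
  from assms(1) show ?thesis
  proof induction
    case (const c)
    show ?case by (intro exI[of _ 0] bexI[of _ "\<lambda>_. c"]) (auto intro: polyfun.const)
  next
    case (var i)
    thus ?case by (intro exI[of _ 0] bexI[of _ "\<lambda>x. x i"]) (auto intro: polyfun_var)
  next
    case (add f g)
    then obtain N p M q where p: "p \<in> polyfun V" "q \<in> polyfun V"
      and fg: "\<forall>x. 1 - S * x 0 \<noteq> 0 \<longrightarrow> f x * (1 - S * x 0) ^ N = p x"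
        "\<forall>x. 1 - S * x 0 \<noteq> 0 \<longrightarrow> g x * (1 - S * x 0) ^ M = q x"
      by blast
    have "(f x + g x) * (1 - S * x 0) ^ (N + M) =
        (f x * (1 - S * x 0) ^ N) * (1 - S * x 0) ^ M + (g x * (1 - S * x 0) ^ M) * (1 - S * x 0) ^ N"
      for x by (simp add: power_add distrib_right mult_ac)
    with fg have "\<forall>x. 1 - S * x 0 \<noteq> 0 \<longrightarrow> (f x + g x) * (1 - S * x 0) ^ (N + M) =
        p x * (1 - S * x 0) ^ M + q x * (1 - S * x 0) ^ N"
      by simp
    moreover have "(\<lambda>x. p x * (1 - S * x 0) ^ M + q x * (1 - S * x 0) ^ N) \<in> polyfun V"
      by (intro polyfun.add polyfun_mult D p)
    ultimately show ?case by (intro exI[of _ "N + M"] bexI)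
  next
    case (mult f g)
    then obtain N p M q where p: "p \<in> polyfun V" "q \<in> polyfun V"
      and fg: "\<forall>x. 1 - S * x 0 \<noteq> 0 \<longrightarrow> f x * (1 - S * x 0) ^ N = p x"
        "\<forall>x. 1 - S * x 0 \<noteq> 0 \<longrightarrow> g x * (1 - S * x 0) ^ M = q x"
      by blast
    have "(f x * g x) * (1 - S * x 0) ^ (N + M) =
        (f x * (1 - S * x 0) ^ N) * (g x * (1 - S * x 0) ^ M)"
      for x by (simp add: power_add mult_ac)
    hence "\<forall>x. 1 - S * x 0 \<noteq> 0 \<longrightarrow> (f x * g x) * (1 - S * x 0) ^ (N + M) = p x * q x"
      using fg by presburger
    moreover have "(\<lambda>x. p x * q x) \<in> polyfun V"
      by (intro polyfun_mult p)
    ultimately show ?case by (intro exI[of _ "N + M"] bexI)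
  next
    case inverse
    show ?case
      by (intro exI[of _ 1] bexI[of _ "\<lambda>_. 1"]) (auto intro: polyfun.const)
  qed
qed

subsection \<open>The linear relations among the derivatives of $f_0$\<close>

text \<open>Pascal's rule, as used in the induction step of the Leibniz rule; \<open>f i j\<close>
  plays the product of an \<open>i\<close>-th and a \<open>j\<close>-th derivative.\<close>

lemma binomial_leibniz_sum:
  fixes f :: "nat \<Rightarrow> nat \<Rightarrow> complex"
  shows "(\<Sum>j\<le>k. of_nat (k choose j) * (f (Suc j) (k - j) + f j (Suc (k - j)))) =
         (\<Sum>j\<le>Suc k. of_nat (Suc k choose j) * f j (Suc k - j))"
proof -
  have "(\<Sum>j\<le>k. of_nat (k choose j) * f j (Suc (k - j))) =
      (\<Sum>j\<le>k. of_nat (k choose j) * f j (Suc k - j))"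
    by (rule sum.cong) (auto simp: Suc_diff_le)
  also have "\<dots> = (\<Sum>j\<le>Suc k. of_nat (k choose j) * f j (Suc k - j))"
    by simp
  also have "\<dots> = f 0 (Suc k) + (\<Sum>j\<le>k. of_nat (k choose Suc j) * f (Suc j) (k - j))"
    by (simp add: sum.atMost_Suc_shift del: sum.atMost_Suc)
  finally show ?thesis
    by (simp add: sum.atMost_Suc_shift distrib_left distrib_right sum.distrib del: sum.atMost_Suc)
qed

text \<open>Both \<open>U\<close> and its product with \<open>\<tau> 0\<close> are reduced by the same coefficients \<open>B\<close>,
  so that \<open>\<tau> 0\<close> itself drops out of the resulting linear relation among \<open>U 0, \<dots>, U (n - 1)\<close>.\<close>

definition relation_coeff ::
  "nat \<Rightarrow> (nat \<Rightarrow> nat \<Rightarrow> complex) \<Rightarrow> (nat \<Rightarrow> complex) \<Rightarrow> nat \<Rightarrow> nat \<Rightarrow> complex" where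
  "relation_coeff n B \<tau> m i =
     (\<Sum>j=1..m. of_nat (m choose j) * \<tau> j * B (m - j) i) -
     (\<Sum>l<n. B m l * (if i < l then of_nat (l choose i) * \<tau> (l - i) else 0))"

text \<open>Write \<open>V l = \<tau> 0 * U l + N l\<close>. As \<open>U\<close> and
  \<open>V\<close> obey the same reduction at order \<open>m\<close>, so does \<open>N\<close>,
  where \<open>\<tau> 0\<close> no longer occurs. Both sides of
  \<open>N m = (\<Sum>l<n. B m l * N l)\<close> are then expanded in
  \<open>U 0, ..., U (n - 1)\<close>: on the left each \<open>U (m - j)\<close> is reduced by
  \<open>B\<close>, on the right the indices are already below \<open>n\<close>.\<close>

lemma relation_coeff_eq_0:
  fixes U V \<tau> :: "nat \<Rightarrow> complex"
  assumes V: "\<And>l. l \<le> m \<Longrightarrow> V l = (\<Sum>j\<le>l. of_nat (l choose j) * \<tau> j * U (l - j))"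
    and U: "\<And>l. l \<le> m \<Longrightarrow> U l = (\<Sum>i<n. B l i * U i)"
    and Vm: "V m = (\<Sum>i<n. B m i * V i)"
    and "n \<le> m"
  shows "(\<Sum>i<n. relation_coeff n B \<tau> m i * U i) = 0"
proof -
  define N where "N l = (\<Sum>j=1..l. of_nat (l choose j) * \<tau> j * U (l - j))" for l
  have VN: "V l = \<tau> 0 * U l + N l" if "l \<le> m" for l
  proof -
    have "{..l} = insert 0 {1..l}" by auto
    thus ?thesis by (simp add: V[OF that] N_def)
  qed
  have "\<tau> 0 * U m + N m = (\<Sum>l<n. B m l * (\<tau> 0 * U l + N l))"
    using Vm VN \<open>n \<le> m\<close> by simp
  also have "\<dots> = \<tau> 0 * (\<Sum>l<n. B m l * U l) + (\<Sum>l<n. B m l * N l)"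
    by (simp add: sum_distrib_left distrib_left sum.distrib mult_ac)
  also have "(\<Sum>l<n. B m l * U l) = U m"
    using U[of m] by simp
  finally have Nm: "N m = (\<Sum>l<n. B m l * N l)" by simp
  have "N m = (\<Sum>j=1..m. of_nat (m choose j) * \<tau> j * (\<Sum>i<n. B (m - j) i * U i))"
    unfolding N_def by (intro sum.cong refl arg_cong2[where f = "(*)"] U) auto
  also have "\<dots> = (\<Sum>j=1..m. \<Sum>i<n. of_nat (m choose j) * \<tau> j * B (m - j) i * U i)"
    by (simp add: sum_distrib_left mult_ac)
  also have "\<dots> = (\<Sum>i<n. (\<Sum>j=1..m. of_nat (m choose j) * \<tau> j * B (m - j) i) * U i)"
    by (subst sum.swap) (simp add: sum_distrib_right)
  finally have 1: "N m = \<dots>" .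
  have 2: "N l = (\<Sum>i<n. (if i < l then of_nat (l choose i) * \<tau> (l - i) else 0) * U i)"
    if "l < n" for l
  proof -
    have "N l = (\<Sum>i<l. of_nat (l choose i) * \<tau> (l - i) * U i)"
      unfolding N_def
      by (rule sum.reindex_bij_witness[of _ "\<lambda>i. l - i" "\<lambda>j. l - j"])
         (auto simp: binomial_symmetric[symmetric])
    also have "\<dots> = (\<Sum>i<n. (if i < l then of_nat (l choose i) * \<tau> (l - i) else 0) * U i)"
      using that by (intro sum.mono_neutral_cong_left) auto
    finally show ?thesis .
  qed
  have "(\<Sum>l<n. B m l * N l) =
      (\<Sum>l<n. \<Sum>i<n. B m l * (if i < l then of_nat (l choose i) * \<tau> (l - i) else 0) * U i)"
    by (intro sum.cong refl) (simp add: 2 sum_distrib_left mult.assoc)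
  also have "\<dots> =
      (\<Sum>i<n. (\<Sum>l<n. B m l * (if i < l then of_nat (l choose i) * \<tau> (l - i) else 0)) * U i)"
    by (subst sum.swap) (simp add: sum_distrib_right)
  finally have 3: "(\<Sum>l<n. B m l * N l) = \<dots>" .
  show ?thesis
    using Nm unfolding 1 3 relation_coeff_def
    by (simp add: left_diff_distrib sum_subtractf)
qed

text \<open>Index 0 never occurs. It may therefore hold \<open>t\<close> in one family and
  \<open>z\<close> in the other.\<close>

lemma relation_coeff_cong:
  assumes "\<And>j. j \<ge> 1 \<Longrightarrow> \<tau> j = \<tau>' j"
  shows "relation_coeff n B \<tau> m i = relation_coeff n B \<tau>' m i"
  unfolding relation_coeff_def using assms
  by (intro arg_cong2[where f = "(-)"] sum.cong refl) auto

lemma locfun_relation_coeff: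
  assumes "\<And>m i. \<beta> m i \<in> ratfun S" "0 \<in> V" "{1..m} \<subseteq> V" "{1..<n} \<subseteq> V"
  shows "(\<lambda>x. relation_coeff n (\<lambda>m i. \<beta> m i (x 0)) x m i) \<in> locfun S V"
proof -
  have "(\<lambda>x. if i < l then of_nat (l choose i) * x (l - i) else 0) \<in> locfun S V" if "l < n" for l
  proof (cases "i < l")
    case True
    with that have "l - i \<in> {1..<n}" by auto
    with assms(4) have "l - i \<in> V" by blast
    with True show ?thesis by (auto intro!: locfun.mult locfun.const locfun.var)
  qed (simp add: locfun.const)
  moreover have "(\<lambda>x. x j) \<in> locfun S V" if "j \<in> {1..m}" for j
    using that assms(3) by (auto intro: locfun.var)
  ultimately show ?thesis
    unfolding relation_coeff_def
    by (intro locfun_diff locfun_sum locfun.mult locfun.const locfun_ratfun assms(1,2)) auto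
qed

text \<open>At the point where \<open>x (n - 1) = 1\<close> and all other variables vanish, the minor belonging to the
  coefficient of the top variable is a diagonal matrix with binomial coefficients on the diagonal.
  This shows that the linear system determines the top variable generically.\<close>

lemma relation_coeff_special_point:
  assumes "\<And>m i. m < n \<Longrightarrow> B m i = (if i = m then 1 else 0)"
    and "n \<ge> 2" "k < n - 1" "1 \<le> i" "i < n"
  defines "\<xi> \<equiv> \<lambda>j. if j = n - 1 then 1 else 0"
  shows "relation_coeff n B \<xi> (n + k) i = (if i = Suc k then of_nat ((n + k) choose (n - 1)) else 0)"
proof -
  have "(\<Sum>j=1..n + k. of_nat ((n + k) choose j) * \<xi> j * B (n + k - j) i) =
      (\<Sum>j\<in>{n - 1}. of_nat ((n + k) choose j) * \<xi> j * B (n + k - j) i)"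
    using assms(2) by (intro sum.mono_neutral_right) (auto simp: \<xi>_def)
  also have "\<dots> = (if i = Suc k then of_nat ((n + k) choose (n - 1)) else 0)"
  proof -
    have "n + k - (n - 1) = Suc k" using assms(2) by simp
    thus ?thesis using assms(1)[of "Suc k" i] assms(3) by (simp add: \<xi>_def)
  qed
  finally have "(\<Sum>j=1..n + k. of_nat ((n + k) choose j) * \<xi> j * B (n + k - j) i) =
      (if i = Suc k then of_nat ((n + k) choose (n - 1)) else 0)" .
  \<comment> \<open>A nonzero term would need \<open>l - i = n - 1\<close> with
    \<open>l < n\<close>, which forces \<open>i = 0\<close>.\<close>
  moreover have "(\<Sum>l<n. B (n + k) l * (if i < l then of_nat (l choose i) * \<xi> (l - i) else 0)) = 0"
    using assms(4) by (intro sum.neutral) (auto simp: \<xi>_def)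
  ultimately show ?thesis
    unfolding relation_coeff_def by simp
qed

lemma det_eq_0_if_kernel:
  fixes e :: "nat \<Rightarrow> nat \<Rightarrow> complex"
  assumes "\<And>k. k < n \<Longrightarrow> (\<Sum>i<n. e k i * u i) = 0" "u 0 \<noteq> 0" "0 < n"
  shows "det (mat n n (\<lambda>(k, i). e k i)) = 0"
proof -
  define A where "A = mat n n (\<lambda>(k, i). e k i)"
  have "A *\<^sub>v vec n u = 0\<^sub>v n"
  proof (rule eq_vecI)
    fix k assume "k < dim_vec (0\<^sub>v n :: complex vec)"
    thus "(A *\<^sub>v vec n u) $ k = 0\<^sub>v n $ k"
      using assms(1)[of k] by (simp add: A_def scalar_prod_def atLeast0LessThan)
  qed (simp add: A_def)
  moreover have "vec n u \<noteq> 0\<^sub>v n"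
  proof
    assume "vec n u = 0\<^sub>v n"
    hence "vec n u $ 0 = 0\<^sub>v n $ 0" by simp
    with assms(2,3) show False by simp
  qed
  ultimately show ?thesis
    using det_0_iff_vec_prod_zero[of A n] unfolding A_def by (metis mat_carrier vec_carrier)
qed

text \<open>Row \<open>k\<close> of the system involves variables up to index \<open>n + k\<close>
  only, so Laplace expansion along the last row isolates the top variable. The kernel vector is
  nonzero thanks to \<open>U 0\<close>.\<close>

lemma top_variable_generated_or_algebraic:
  fixes x U :: "nat \<Rightarrow> complex \<Rightarrow> complex"
  assumes n: "n \<ge> 2"
    and \<beta>: "\<And>m i. \<beta> m i \<in> ratfun S"
    and \<beta>_unit: "\<And>m i y. m < n \<Longrightarrow> \<beta> m i y = (if i = m then 1 else 0)"
    and mer: "\<And>i. meromorphic_in_exp (x i)"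
    and rel: "\<And>k. k < n \<Longrightarrow> \<forall>\<^sub>F t in at_left_infinity. (\<Sum>i<n.
      relation_coeff n (\<lambda>m i. \<beta> m i (x 0 t)) (\<lambda>i. x i t) (n + k) i * U i t) = 0"
    and U: "\<forall>\<^sub>F t in at_left_infinity. U 0 t \<noteq> 0"
    and S: "\<forall>\<^sub>F t in at_left_infinity. 1 - S * x 0 t \<noteq> 0"
  shows "x (2 * n - 1) \<in> germ_field (x ` {..2 * n - 2}) \<or>
         (\<exists>m<2 * n - 1. algebraic_germ (x ` {..<m}) (x m))"
proof -
  define c where "c k i X = relation_coeff n (\<lambda>m i. \<beta> m i (X 0)) X (n + k) i" for k i X
  define V where "V = {..2 * n - 2}"
  have V0: "0 \<in> V" by (simp add: V_def)
  have c_mem: "c k i \<in> locfun S V" if "k < n - 1" for k i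
    unfolding c_def using that by (intro locfun_relation_coeff[OF \<beta> V0]) (auto simp: V_def)
  \<comment> \<open>The last row without its summand \<open>j = 2 * n - 1\<close>. That summand is
    \<open>X (2 * n - 1) * \<beta> 0 i (X 0)\<close>, which by \<open>\<beta>_unit\<close> survives
    in column 0 alone.\<close>
  define lower where "lower i X = (\<Sum>j=1..2 * n - 2. of_nat ((2 * n - 1) choose j) * X j *
      \<beta> (2 * n - 1 - j) i (X 0)) -
     (\<Sum>l<n. \<beta> (2 * n - 1) l (X 0) * (if i < l then of_nat (l choose i) * X (l - i) else 0))"
    for i and X :: "nat \<Rightarrow> complex"
  have last_row: "c (n - 1) i X = lower i X + (if i = 0 then X (2 * n - 1) else 0)" for i X
  proof -
    have nn: "n + (n - 1) = 2 * n - 1" using n by simp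
    have "{1..2 * n - 1} = insert (2 * n - 1) {1..2 * n - 2}" using n by auto
    moreover have "2 * n - 1 \<notin> {1..2 * n - 2}" using n by auto
    ultimately have "(\<Sum>j=1..2 * n - 1. of_nat ((2 * n - 1) choose j) * X j * \<beta> (2 * n - 1 - j) i (X 0)) =
        (if i = 0 then X (2 * n - 1) else 0) +
        (\<Sum>j=1..2 * n - 2. of_nat ((2 * n - 1) choose j) * X j * \<beta> (2 * n - 1 - j) i (X 0))"
      using n \<beta>_unit[of 0 i] by (simp only: sum.insert finite_atLeastAtMost) simp
    moreover have "u + v - w = v - w + u" for u v w :: complex by simp
    ultimately show ?thesis by (simp only: c_def lower_def relation_coeff_def nn)
  qed
  have if_mem: "(\<lambda>X. if i < l then of_nat (l choose i) * X (l - i) else 0) \<in> locfun S V"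
    if "l < n" for l i
    using that by (cases "i < l") (auto simp: V_def intro!: locfun.mult locfun.const locfun.var)
  have lower_mem: "lower i \<in> locfun S V" for i
    unfolding lower_def using if_mem
    by (intro locfun_diff locfun_sum locfun.mult locfun.const locfun_ratfun \<beta> V0 locfun.var)
       (auto simp: V_def)
  \<comment> \<open>Written out with the first \<open>n - 1\<close> rows, which makes visible that
    the top variable does not occur.\<close>
  define cof where "cof i X = (- 1) ^ (n - 1 + i) *
      det (mat (n - 1) (n - 1) (\<lambda>(k, j). c k (if j < i then j else Suc j) X))" for i X
  have cof_mem: "cof i \<in> locfun S V" for i
    unfolding cof_def by (intro locfun.mult locfun.const locfun_det c_mem)
  have cof: "cofactor (mat n n (\<lambda>(k, i). c k i X)) (n - 1) i = cof i X" if "i < n" for i X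
  proof -
    have "mat_delete (mat n n (\<lambda>(k, i). c k i X)) (n - 1) i =
        mat (n - 1) (n - 1) (\<lambda>(k, j). c k (if j < i then j else Suc j) X)"
      using that by (intro eq_matI) (auto simp: mat_delete_def)
    thus ?thesis by (simp add: cofactor_def cof_def)
  qed
  have "\<forall>\<^sub>F t in at_left_infinity. \<forall>k\<in>{..<n}. (\<Sum>i<n. c k i (\<lambda>i. x i t) * U i t) = 0"
    by (rule eventually_ball_finite) (use rel in \<open>auto simp: c_def\<close>)
  with U have expansion: "\<forall>\<^sub>F t in at_left_infinity.
      (\<Sum>i<n. lower i (\<lambda>i. x i t) * cof i (\<lambda>i. x i t)) + x (2 * n - 1) t * cof 0 (\<lambda>i. x i t) = 0"
  proof eventually_elim
    case (elim t)
    define X where "X = (\<lambda>i. x i t)"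
    define A where "A = mat n n (\<lambda>(k, i). c k i X)"
    have "det A = 0"
      unfolding A_def using elim n
      by (intro det_eq_0_if_kernel[where u = "\<lambda>i. U i t"]) (auto simp: X_def)
    moreover have "det A = (\<Sum>i<n. A $$ (n - 1, i) * cofactor A (n - 1) i)"
      using n by (intro laplace_expansion_row) (auto simp: A_def)
    moreover have "\<dots> = (\<Sum>i<n. c (n - 1) i X * cof i X)"
      unfolding A_def using n by (intro sum.cong) (auto simp: cof simp del: One_nat_def)
    ultimately have "(\<Sum>i<n. (lower i X + (if i = 0 then X (2 * n - 1) else 0)) * cof i X) = 0"
      by (simp only: last_row)
    also have "(\<Sum>i<n. (lower i X + (if i = 0 then X (2 * n - 1) else 0)) * cof i X) =
        (\<Sum>i<n. lower i X * cof i X) + (\<Sum>i<n. if i = 0 then X (2 * n - 1) * cof i X else 0)"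
      unfolding sum.distrib[symmetric] by (rule sum.cong) (auto simp: distrib_right)
    finally show ?case
      using n by (simp add: X_def)
  qed
  define \<xi> :: "nat \<Rightarrow> complex" where "\<xi> j = (if j = n - 1 then 1 else 0)" for j
  have "cof 0 \<xi> \<noteq> 0"
  proof -
    define M where "M = mat (n - 1) (n - 1) (\<lambda>(k, j). c k (Suc j) \<xi>)"
    have M: "M $$ (k, j) = (if j = k then of_nat ((n + k) choose (n - 1)) else 0)"
      if "k < n - 1" "j < n - 1" for k j
    proof -
      have "c k (Suc j) \<xi> = (if Suc j = Suc k then of_nat ((n + k) choose (n - 1)) else 0)"
        unfolding c_def \<xi>_def
        by (rule relation_coeff_special_point) (use n that \<beta>_unit in auto)
      thus ?thesis using that by (simp add: M_def)
    qed
    have "upper_triangular M" using M by (auto simp: M_def)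
    hence "det M = (\<Prod>k = 0..<n - 1. M $$ (k, k))"
      using det_upper_triangular[of M "n - 1"] by (simp add: prod_list_diag_prod) (simp add: M_def)
    also have "\<dots> \<noteq> 0"
      using M by (auto simp: binomial_eq_0_iff)
    finally show ?thesis by (simp add: cof_def M_def)
  qed
  from locfun_clear_denominators[OF cof_mem[of 0] V0] obtain N p
    where p: "p \<in> polyfun V" "\<And>X. 1 - S * X 0 \<noteq> 0 \<Longrightarrow> cof 0 X * (1 - S * X 0) ^ N = p X"
    by blast
  \<comment> \<open>The cleared denominator is 1 at \<xi>, so the nonvanishing of the cofactor
    passes to \<open>p\<close>.\<close>
  have "\<xi> 0 = 0" using n by (simp add: \<xi>_def)
  with \<open>cof 0 \<xi> \<noteq> 0\<close> p(2)[of \<xi>] have "p \<xi> \<noteq> 0" by auto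
  have fieldV: "(\<lambda>t. f (\<lambda>i. x i t)) \<in> germ_field (x ` V)" if "f \<in> locfun S V" for f
    using that V0 by (rule locfun_germ_field)
  have "meromorphic_in_exp (\<lambda>t. cof 0 (\<lambda>i. x i t))"
    using fieldV[OF cof_mem[of 0]] by (rule germ_field_meromorphic) (use mer in auto)
  from meromorphic_in_exp_dichotomy[OF this] show ?thesis
  proof
    assume "\<forall>\<^sub>F t in at_left_infinity. cof 0 (\<lambda>i. x i t) = 0"
    with S have "\<forall>\<^sub>F t in at_left_infinity. p (\<lambda>i. x i t) = 0"
    proof eventually_elim
      case (elim t)
      with p(2)[of "\<lambda>i. x i t"] show ?case by simp
    qed
    moreover have "p \<in> polyfun {..<2 * n - 1}"
      using p(1) by (rule polyfun_mono) (use n in \<open>auto simp: V_def\<close>)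
    ultimately show ?thesis
      using vanishing_polyfun_imp_algebraic[of p "2 * n - 1" \<xi> x] \<open>p \<xi> \<noteq> 0\<close> mer by blast
  next
    assume "\<forall>\<^sub>F t in at_left_infinity. cof 0 (\<lambda>i. x i t) \<noteq> 0"
    with expansion have "\<forall>\<^sub>F t in at_left_infinity.
        - (\<Sum>i<n. lower i (\<lambda>i. x i t) * cof i (\<lambda>i. x i t)) / cof 0 (\<lambda>i. x i t) = x (2 * n - 1) t"
    proof eventually_elim
      case (elim t)
      from elim(1) have "- (\<Sum>i<n. lower i (\<lambda>i. x i t) * cof i (\<lambda>i. x i t)) =
          x (2 * n - 1) t * cof 0 (\<lambda>i. x i t)" by (rule minus_unique)
      with elim(2) show ?case by simp
    qed
    moreover have "(\<lambda>t. - (\<Sum>i<n. lower i (\<lambda>i. x i t) * cof i (\<lambda>i. x i t)) /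
        cof 0 (\<lambda>i. x i t)) \<in> germ_field (x ` V)"
      by (intro germ_field_divide germ_field_uminus germ_field_sum germ_field.mult
          fieldV lower_mem cof_mem)
    ultimately have "x (2 * n - 1) \<in> germ_field (x ` V)"
      by - (rule germ_field.cong)
    thus ?thesis by (simp add: V_def)
  qed
qed

section \<open>From fields of germs to formal differential polynomials\<close>

lemma polyfun_cong:
  assumes "f \<in> polyfun V" "\<And>i. i \<in> V \<Longrightarrow> x i = y i"
  shows "f x = f y"
  using assms(1) by induction (simp_all add: assms(2))

text \<open>Only inversion is delicate: by the dichotomy the numerator is either the zero germ, and
  the total inverse is \<open>0 / 1\<close>, or free of zeros far to the left, and the quotient can
  be turned over.\<close>

lemma germ_field_eq_quotient:
  assumes "f \<in> germ_field (x ` V)" and mer: "\<And>i. meromorphic_in_exp (x i)"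
  shows "\<exists>A\<in>polyfun V. \<exists>B\<in>polyfun V. \<forall>\<^sub>F t in at_left_infinity.
           B (\<lambda>i. x i t) \<noteq> 0 \<and> f t = A (\<lambda>i. x i t) / B (\<lambda>i. x i t)"
  using assms(1)
proof induction
  case (gen g)
  then obtain i where "i \<in> V" "g = x i" by auto
  thus ?case
    by (intro bexI[of _ "\<lambda>x. x i"] bexI[of _ "\<lambda>_. 1"]) (auto intro: polyfun_var polyfun.const)
next
  case (const c)
  show ?case
    by (intro bexI[of _ "\<lambda>x. c"] bexI[of _ "\<lambda>_. 1"]) (auto intro: polyfun.const)
next
  case (add f g)
  then obtain A B C D where P: "A \<in> polyfun V" "B \<in> polyfun V" "C \<in> polyfun V" "D \<in> polyfun V"
    and ev: "\<forall>\<^sub>F t in at_left_infinity. B (\<lambda>i. x i t) \<noteq> 0 \<and> f t = A (\<lambda>i. x i t) / B (\<lambda>i. x i t)"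
      "\<forall>\<^sub>F t in at_left_infinity. D (\<lambda>i. x i t) \<noteq> 0 \<and> g t = C (\<lambda>i. x i t) / D (\<lambda>i. x i t)"
    by blast
  show ?case
  proof (intro bexI)
    show "\<forall>\<^sub>F t in at_left_infinity. B (\<lambda>i. x i t) * D (\<lambda>i. x i t) \<noteq> 0 \<and> f t + g t =
        (A (\<lambda>i. x i t) * D (\<lambda>i. x i t) + C (\<lambda>i. x i t) * B (\<lambda>i. x i t)) /
        (B (\<lambda>i. x i t) * D (\<lambda>i. x i t))"
      using ev by eventually_elim (simp add: add_frac_eq)
  qed (intro polyfun.add polyfun_mult P)+
next
  case (mult f g)
  then obtain A B C D where P: "A \<in> polyfun V" "B \<in> polyfun V" "C \<in> polyfun V" "D \<in> polyfun V"
    and ev: "\<forall>\<^sub>F t in at_left_infinity. B (\<lambda>i. x i t) \<noteq> 0 \<and> f t = A (\<lambda>i. x i t) / B (\<lambda>i. x i t)"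
      "\<forall>\<^sub>F t in at_left_infinity. D (\<lambda>i. x i t) \<noteq> 0 \<and> g t = C (\<lambda>i. x i t) / D (\<lambda>i. x i t)"
    by blast
  show ?case
  proof (intro bexI)
    show "\<forall>\<^sub>F t in at_left_infinity. B (\<lambda>i. x i t) * D (\<lambda>i. x i t) \<noteq> 0 \<and> f t * g t =
        (A (\<lambda>i. x i t) * C (\<lambda>i. x i t)) / (B (\<lambda>i. x i t) * D (\<lambda>i. x i t))"
      using ev by eventually_elim simp
  qed (intro polyfun_mult P)+
next
  case (inverse f)
  then obtain A B where P: "A \<in> polyfun V" "B \<in> polyfun V"
    and ev: "\<forall>\<^sub>F t in at_left_infinity. B (\<lambda>i. x i t) \<noteq> 0 \<and> f t = A (\<lambda>i. x i t) / B (\<lambda>i. x i t)"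
    by blast
  have "meromorphic_in_exp (\<lambda>t. A (\<lambda>i. x i t))"
    using polyfun_germ_field[OF P(1)] by (rule germ_field_meromorphic) (use mer in auto)
  from meromorphic_in_exp_dichotomy[OF this] show ?case
  proof
    assume "\<forall>\<^sub>F t in at_left_infinity. A (\<lambda>i. x i t) = 0"
    with ev have "\<forall>\<^sub>F t in at_left_infinity. (1 :: complex) \<noteq> 0 \<and> inverse (f t) = 0 / 1"
      by eventually_elim simp
    thus ?thesis
      by (intro bexI[of _ "\<lambda>_. 0"] bexI[of _ "\<lambda>_. 1"]) (auto intro: polyfun.const)
  next
    assume "\<forall>\<^sub>F t in at_left_infinity. A (\<lambda>i. x i t) \<noteq> 0"
    with ev have "\<forall>\<^sub>F t in at_left_infinity.
        A (\<lambda>i. x i t) \<noteq> 0 \<and> inverse (f t) = B (\<lambda>i. x i t) / A (\<lambda>i. x i t)"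
      by eventually_elim simp
    with P show ?thesis by (intro bexI[of _ A] bexI[of _ B])
  qed
next
  case (cong f g)
  then obtain A B where P: "A \<in> polyfun V" "B \<in> polyfun V"
    and ev: "\<forall>\<^sub>F t in at_left_infinity. B (\<lambda>i. x i t) \<noteq> 0 \<and> f t = A (\<lambda>i. x i t) / B (\<lambda>i. x i t)"
    by blast
  from ev cong.hyps(2) have "\<forall>\<^sub>F t in at_left_infinity.
      B (\<lambda>i. x i t) \<noteq> 0 \<and> g t = A (\<lambda>i. x i t) / B (\<lambda>i. x i t)"
    by eventually_elim simp
  with P show ?case by (intro bexI[of _ A] bexI[of _ B])
qed

text \<open>The equation is \<open>B * X (Suc m) - A = 0\<close>. That its order is exactly
  \<open>Suc m\<close> concerns the monomials of a formal polynomial \<open>T\<close> known only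
  through its values, so the occurrence of the top variable is read off from values.\<close>

lemma germ_field_imp_algebraic_ode:
  assumes "(deriv ^^ Suc m) y \<in> germ_field ((\<lambda>k. (deriv ^^ k) y) ` {..m})"
    and mer: "\<And>k. meromorphic_in_exp ((deriv ^^ k) y)"
  shows "satisfies_algebraic_ode (Suc m) y \<and> in_jet_field m y ((deriv ^^ Suc m) y)"
proof -
  define jet where "jet t k = (deriv ^^ k) y t" for t k
  obtain A B where A: "A \<in> polyfun {..m}" and B: "B \<in> polyfun {..m}"
    and ev: "\<forall>\<^sub>F t in at_left_infinity. B (jet t) \<noteq> 0 \<and> jet t (Suc m) = A (jet t) / B (jet t)"
    using germ_field_eq_quotient[OF assms(1) mer] by (auto simp: jet_def[abs_def])
  obtain P Q where P: "cmpoly_vars P \<subseteq> {..m}" "cmpoly_eval P = A"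
    and Q: "cmpoly_vars Q \<subseteq> {..m}" "cmpoly_eval Q = B"
    by (rule polyfun_imp_cmpoly[OF A], rule polyfun_imp_cmpoly[OF B]) blast
  have "in_jet_field m y ((deriv ^^ Suc m) y)"
    unfolding in_jet_field_def
    by (rule exI[of _ P], rule exI[of _ Q]) (use P Q ev in \<open>simp add: jet_def[abs_def]\<close>)
  moreover define f where "f X = B X * X (Suc m) - A X" for X :: "nat \<Rightarrow> complex"
  have "f \<in> polyfun {..Suc m}"
    unfolding f_def
    by (intro polyfun_diff polyfun_mult polyfun_var polyfun_mono[OF A] polyfun_mono[OF B]) auto
  then obtain T where T: "cmpoly_vars T \<subseteq> {..Suc m}" "cmpoly_eval T = f"
    by (rule polyfun_imp_cmpoly)
  have "Suc m \<in> cmpoly_vars T"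
  proof (rule ccontr)
    assume notin: "Suc m \<notin> cmpoly_vars T"
    have "\<exists>t. B (jet t) \<noteq> 0"
      using eventually_happens[OF ev] by auto
    then obtain t where t: "B (jet t) \<noteq> 0" ..
    \<comment> \<open>Moving only the top coordinate of an actual jet changes \<open>f\<close> by
      \<open>B (jet t)\<close>, which is nonzero.\<close>
    define X where "X a = (jet t)(Suc m := a)" for a
    have "B (X a) = B (jet t)" "A (X a) = A (jet t)" for a
      by (rule polyfun_cong[OF B] polyfun_cong[OF A], simp add: X_def)+
    moreover have "f (X 0) = f (X 1)"
      unfolding T(2)[symmetric] by (rule cmpoly_eval_cong) (use notin in \<open>auto simp: X_def\<close>)
    ultimately show False using t by (simp add: f_def X_def)
  qed
  moreover have "\<forall>\<^sub>F t in at_left_infinity. cmpoly_eval T (jet t) = 0"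
    using ev by eventually_elim (simp add: T(2) f_def)
  hence "satisfies_algebraic_ode (Suc m) y"
    unfolding satisfies_algebraic_ode_def using T(1) \<open>Suc m \<in> cmpoly_vars T\<close>
    by (auto simp: jet_def[abs_def])
  ultimately show ?thesis by blast
qed

text \<open>The field generated by no germs consists of constants. A germ algebraic over it stays
  among the finitely many roots of one polynomial, whereas \<open>y\<close> tends to 0 without being
  0.\<close>

lemma not_algebraic_germ_empty:
  assumes "filterlim y (at 0) at_left_infinity"
  shows "\<not> algebraic_germ {} y"
proof
  assume "algebraic_germ {} y"
  then obtain d a where a: "\<And>k. a k \<in> germ_field {}"
    "\<forall>\<^sub>F t in at_left_infinity. a d t \<noteq> 0"
    "\<forall>\<^sub>F t in at_left_infinity. (\<Sum>k\<le>d. a k t * y t ^ k) = 0"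
    by (auto simp: algebraic_germ_def)
  have "\<exists>c. \<forall>\<^sub>F t in at_left_infinity. f t = c" if "f \<in> germ_field {}" for f
    using that
  proof induction
    case (add f g)
    then obtain c e where "\<forall>\<^sub>F t in at_left_infinity. f t = c" "\<forall>\<^sub>F t in at_left_infinity. g t = e"
      by blast
    hence "\<forall>\<^sub>F t in at_left_infinity. f t + g t = c + e" by eventually_elim simp
    thus ?case ..
  next
    case (mult f g)
    then obtain c e where "\<forall>\<^sub>F t in at_left_infinity. f t = c" "\<forall>\<^sub>F t in at_left_infinity. g t = e"
      by blast
    hence "\<forall>\<^sub>F t in at_left_infinity. f t * g t = c * e" by eventually_elim simp
    thus ?case ..
  next
    case (inverse f)
    then obtain c where "\<forall>\<^sub>F t in at_left_infinity. f t = c" by blast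
    hence "\<forall>\<^sub>F t in at_left_infinity. inverse (f t) = inverse c" by eventually_elim simp
    thus ?case ..
  next
    case (cong f g)
    then obtain c where "\<forall>\<^sub>F t in at_left_infinity. f t = c" by blast
    with cong.hyps(2) have "\<forall>\<^sub>F t in at_left_infinity. g t = c" by eventually_elim simp
    thus ?case ..
  qed auto
  hence "\<forall>k. \<exists>c. \<forall>\<^sub>F t in at_left_infinity. a k t = c"
    using a(1) by blast
  from choice[OF this] obtain c where c: "\<And>k. \<forall>\<^sub>F t in at_left_infinity. a k t = c k"
    by blast
  define p where "p = (\<Sum>k\<le>d. monom (c k) k)"
  have all: "\<forall>\<^sub>F t in at_left_infinity. \<forall>k\<in>{..d}. a k t = c k"
    by (rule eventually_ball_finite) (use c in auto)
  have "coeff p d = c d"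
    by (simp add: p_def coeff_sum)
  moreover have "\<forall>\<^sub>F t in at_left_infinity. c d \<noteq> 0"
    using a(2) c[of d] by eventually_elim simp
  ultimately have "p \<noteq> 0" by auto
  hence "finite {w. poly p w = 0}" by (rule poly_roots_finite)
  hence "\<not> 0 islimpt {w. poly p w = 0}" by (rule islimpt_finite)
  hence "\<forall>\<^sub>F w in at 0. poly p w \<noteq> 0" by (simp add: islimpt_iff_eventually)
  with assms have "\<forall>\<^sub>F t in at_left_infinity. poly p (y t) \<noteq> 0"
    by (auto simp: filterlim_iff)
  with all a(3) have "\<forall>\<^sub>F t in at_left_infinity. False"
  proof eventually_elim
    case (elim t)
    thus False by (simp add: p_def poly_sum poly_monom)
  qed
  thus False by simp
qed

subsection \<open>Sequences of iterated derivatives\<close>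

text \<open>With \<open>\<omega> = z' / z\<close> one has d/dt = \<omega> \<delta>, so this says
  that \<open>Y (Suc k)\<close> is \<delta> applied to \<open>Y k\<close>, with all differentiation
  done in \<open>t\<close>.\<close>

definition jet_chain :: "(complex \<Rightarrow> complex) \<Rightarrow> (nat \<Rightarrow> complex \<Rightarrow> complex) \<Rightarrow> bool" where
  "jet_chain \<omega> Y \<longleftrightarrow>
     (\<forall>k. \<forall>\<^sub>F t in at_left_infinity. (Y k has_field_derivative \<omega> t * Y (Suc k) t) (at t))"

lemma jet_chain_unique:
  assumes "jet_chain \<omega> A" "jet_chain \<omega> B" and \<omega>: "\<forall>\<^sub>F t in at_left_infinity. \<omega> t \<noteq> 0"
    and 0: "\<forall>\<^sub>F t in at_left_infinity. A 0 t = B 0 t"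
  shows "\<forall>\<^sub>F t in at_left_infinity. A k t = B k t"
proof (induction k)
  case (Suc k)
  have "\<forall>\<^sub>F t in at_left_infinity. (A k has_field_derivative \<omega> t * A (Suc k) t) (at t)"
    "\<forall>\<^sub>F t in at_left_infinity. (B k has_field_derivative \<omega> t * B (Suc k) t) (at t)"
    using assms(1,2) by (simp_all add: jet_chain_def)
  with eventually_has_field_derivative_cong[OF Suc this(1)] \<omega> show ?case
    by eventually_elim (auto dest: DERIV_unique)
qed (rule 0)

lemma jet_chain_mult:
  assumes "jet_chain \<omega> A" "jet_chain \<omega> B"
  shows "jet_chain \<omega> (\<lambda>k t. \<Sum>j\<le>k. of_nat (k choose j) * A j t * B (k - j) t)"
  unfolding jet_chain_def
proof
  fix k
  have "\<forall>\<^sub>F t in at_left_infinity. \<forall>j\<in>{..k}. (A j has_field_derivative \<omega> t * A (Suc j) t) (at t)"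
    "\<forall>\<^sub>F t in at_left_infinity. \<forall>j\<in>{..k}. (B j has_field_derivative \<omega> t * B (Suc j) t) (at t)"
    by (rule eventually_ball_finite; use assms in \<open>simp add: jet_chain_def\<close>)+
  thus "\<forall>\<^sub>F t in at_left_infinity.
      ((\<lambda>t. \<Sum>j\<le>k. of_nat (k choose j) * A j t * B (k - j) t) has_field_derivative
       \<omega> t * (\<Sum>j\<le>Suc k. of_nat (Suc k choose j) * A j t * B (Suc k - j) t)) (at t)"
  proof eventually_elim
    case (elim t)
    have "((\<lambda>t. of_nat (k choose j) * A j t * B (k - j) t) has_field_derivative
        \<omega> t * (of_nat (k choose j) * (A (Suc j) t * B (k - j) t + A j t * B (Suc (k - j)) t))) (at t)"
      if "j \<le> k" for j
    proof -
      have "(A j has_field_derivative \<omega> t * A (Suc j) t) (at t)"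
        "(B (k - j) has_field_derivative \<omega> t * B (Suc (k - j)) t) (at t)"
        using elim that by auto
      thus ?thesis
        by (auto intro!: derivative_eq_intros simp: algebra_simps)
    qed
    hence "((\<lambda>t. \<Sum>j\<le>k. of_nat (k choose j) * A j t * B (k - j) t) has_field_derivative
        (\<Sum>j\<le>k. \<omega> t * (of_nat (k choose j) * (A (Suc j) t * B (k - j) t + A j t * B (Suc (k - j)) t))))
        (at t)"
      by (intro DERIV_sum) auto
    thus ?case
      using binomial_leibniz_sum[where f = "\<lambda>i j. A i t * B j t" and k = k]
      by (simp add: sum_distrib_left[symmetric] mult.assoc del: sum.atMost_Suc binomial_Suc_Suc)
  qed
qed

text \<open>The coefficients are chosen before \<open>Y\<close>, so both solutions are reduced by
  the same ones. The explicit unit vectors for \<open>m < n\<close> are what makes the special point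
  computable.\<close>

lemma jet_chain_reduction:
  assumes z: "\<forall>\<^sub>F t in at_left_infinity. (z has_field_derivative \<omega> t * z t) (at t)"
    and \<omega>: "\<forall>\<^sub>F t in at_left_infinity. \<omega> t \<noteq> 0"
    and S: "\<forall>\<^sub>F t in at_left_infinity. 1 - S * z t \<noteq> 0"
    and r: "\<And>i. r i \<in> ratfun S" and "n \<ge> 1"
  shows "\<exists>b. (\<forall>i. b i \<in> ratfun S) \<and> (m < n \<longrightarrow> (\<forall>i y. b i y = (if i = m then 1 else 0))) \<and>
    (\<forall>Y. jet_chain \<omega> Y \<and> (\<forall>\<^sub>F t in at_left_infinity. Y n t = (\<Sum>i<n. r i (z t) * Y i t)) \<longrightarrow>
      (\<forall>\<^sub>F t in at_left_infinity. Y m t = (\<Sum>i<n. b i (z t) * Y i t)))"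
proof (cases "m < n")
  case True
  have "Y m t = (\<Sum>i<n. (if i = m then 1 else 0) * Y i t)" for Y :: "nat \<Rightarrow> complex \<Rightarrow> complex" and t
  proof -
    have "(\<Sum>i<n. (if i = m then 1 else 0) * Y i t) = (\<Sum>i<n. if i = m then Y i t else 0)"
      by (rule sum.cong) auto
    thus ?thesis using True by simp
  qed
  thus ?thesis
    by (intro exI[of _ "\<lambda>i y. if i = m then 1 else 0"]) (auto intro: ratfun.const)
next
  case False
  hence "n \<le> m" by simp
  hence "\<exists>b. (\<forall>i. b i \<in> ratfun S) \<and>
    (\<forall>Y. jet_chain \<omega> Y \<and> (\<forall>\<^sub>F t in at_left_infinity. Y n t = (\<Sum>i<n. r i (z t) * Y i t)) \<longrightarrow>
      (\<forall>\<^sub>F t in at_left_infinity. Y m t = (\<Sum>i<n. b i (z t) * Y i t)))"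
  proof (induction m rule: dec_induct)
    case base
    show ?case using r by (intro exI[of _ r]) auto
  next
    case (step m)
    then obtain b where b: "\<And>i. b i \<in> ratfun S"
      and red: "\<And>Y. jet_chain \<omega> Y \<Longrightarrow>
          \<forall>\<^sub>F t in at_left_infinity. Y n t = (\<Sum>i<n. r i (z t) * Y i t) \<Longrightarrow>
          \<forall>\<^sub>F t in at_left_infinity. Y m t = (\<Sum>i<n. b i (z t) * Y i t)"
      by blast
    obtain b' where b': "\<And>i. b' i \<in> ratfun S"
      and der: "\<And>i y. 1 - S * y \<noteq> 0 \<Longrightarrow> (b i has_field_derivative b' i y) (at y)"
      using choice[of "\<lambda>i b'. b' \<in> ratfun S \<and> (\<forall>y. 1 - S * y \<noteq> 0 \<longrightarrow> (b i has_field_derivative b' y) (at y))"]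
        ratfun_deriv[OF b] by blast
    obtain n' where n': "n = Suc n'" using \<open>n \<ge> 1\<close> by (cases n) auto
    \<comment> \<open>Apply \<delta> to the sum of \<open>b i * Y i\<close>: on functions of
      \<open>z\<close> it acts as \<open>y\<close> d/dy, the indices of \<open>Y\<close> shift by
      one, and the new \<open>Y n\<close> is replaced by means of \<open>r\<close>.\<close>
    define B where "B i y = y * b' i y + (if i = 0 then 0 else b (i - 1) y) + b n' y * r i y" for i y
    have "B i \<in> ratfun S" for i
    proof -
      have "(\<lambda>y. if i = 0 then 0 else b (i - 1) y) \<in> ratfun S"
        using b by (cases "i = 0") (auto intro: ratfun.const)
      thus ?thesis
        unfolding B_def by (intro ratfun.add ratfun.mult ratfun.id b b' r)
    qed
    moreover have "\<forall>\<^sub>F t in at_left_infinity. Y (Suc m) t = (\<Sum>i<n. B i (z t) * Y i t)"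
      if Y: "jet_chain \<omega> Y" and rel: "\<forall>\<^sub>F t in at_left_infinity. Y n t = (\<Sum>i<n. r i (z t) * Y i t)"
      for Y
    proof -
      have Ym: "\<forall>\<^sub>F t in at_left_infinity. (Y m has_field_derivative \<omega> t * Y (Suc m) t) (at t)"
        using Y by (simp add: jet_chain_def)
      have Yi: "\<forall>\<^sub>F t in at_left_infinity. \<forall>i\<in>{..<n}. (Y i has_field_derivative \<omega> t * Y (Suc i) t) (at t)"
        by (rule eventually_ball_finite) (use Y in \<open>simp_all add: jet_chain_def\<close>)
      from eventually_has_field_derivative_cong[OF red[OF Y rel] Ym] Yi z S \<omega> rel
      show ?thesis
      proof eventually_elim
        case (elim t)
        have "((\<lambda>t. b i (z t) * Y i t) has_field_derivative
            \<omega> t * (z t * b' i (z t) * Y i t + b i (z t) * Y (Suc i) t)) (at t)" if "i < n" for i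
        proof -
          have "((\<lambda>t. b i (z t)) has_field_derivative b' i (z t) * (\<omega> t * z t)) (at t)"
            using DERIV_chain2[OF der[OF elim(4)] elim(3)] .
          moreover have "(Y i has_field_derivative \<omega> t * Y (Suc i) t) (at t)"
            using elim(2) that by simp
          ultimately show ?thesis
            by (auto intro!: derivative_eq_intros simp: algebra_simps)
        qed
        hence "((\<lambda>t. \<Sum>i<n. b i (z t) * Y i t) has_field_derivative
            (\<Sum>i<n. \<omega> t * (z t * b' i (z t) * Y i t + b i (z t) * Y (Suc i) t))) (at t)"
          by (intro DERIV_sum) auto
        from DERIV_unique[OF elim(1) this] elim(5)
        have "Y (Suc m) t = (\<Sum>i<n. z t * b' i (z t) * Y i t + b i (z t) * Y (Suc i) t)"
          by (simp add: sum_distrib_left[symmetric])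
        also have "\<dots> = (\<Sum>i<n. z t * b' i (z t) * Y i t) +
            (\<Sum>i<n'. b i (z t) * Y (Suc i) t) + b n' (z t) * Y n t"
          by (simp add: sum.distrib n')
        also have "(\<Sum>i<n'. b i (z t) * Y (Suc i) t) =
            (\<Sum>i<n. (if i = 0 then 0 else b (i - 1) (z t)) * Y i t)"
          unfolding n' by (simp add: sum.lessThan_Suc_shift del: sum.lessThan_Suc)
        also have "b n' (z t) * Y n t = (\<Sum>i<n. b n' (z t) * r i (z t) * Y i t)"
          by (simp add: elim(6) sum_distrib_left mult.assoc)
        finally show ?case
          by (simp add: B_def sum.distrib distrib_right)
      qed
    qed
    ultimately show ?case by (intro exI[of _ B] conjI allI impI) (simp_all only:)
  qed
  with False show ?thesis by simp
qed

subsection \<open>The jets of the mirror map\<close>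

locale mirror =
  fixes s :: nat and Z :: "complex \<Rightarrow> complex"
  assumes s: "s \<ge> 3" and mirror_map: "is_mirror_map s Z"
begin

definition zt :: "complex \<Rightarrow> complex" where
  "zt t = Z (exp t)"

definition U :: "nat \<Rightarrow> complex \<Rightarrow> complex" where
  "U k t = eval_fps ((fps_theta ^^ k) (mirror_fps s)) (zt t)"

definition W :: "nat \<Rightarrow> complex \<Rightarrow> complex" where
  "W k t = eval_fps ((fps_theta ^^ k) (mirror_log_fps s)) (zt t)"

definition \<omega> :: "complex \<Rightarrow> complex" where
  "\<omega> t = deriv zt t / zt t"

text \<open>Since \<open>\<delta>\<^sub>z = \<omega>\<inverse> d/dt\<close>, the variables are \<open>z\<close> and the iterated
  \<open>\<delta>\<^sub>z\<close>-derivatives of \<open>t\<close>.\<close>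

definition x :: "nat \<Rightarrow> complex \<Rightarrow> complex" where
  "x j = (case j of 0 \<Rightarrow> zt | Suc i \<Rightarrow> ((\<lambda>h t. deriv h t / \<omega> t) ^^ i) (\<lambda>t. 1 / \<omega> t))"

lemma Z_analytic: "Z analytic_on {0}" and Z_0: "Z 0 = 0"
  using mirror_map by (auto simp: is_mirror_map_def)

lemma zt_nz: "\<forall>\<^sub>F t in at_left_infinity. zt t \<noteq> 0"
proof -
  have "\<forall>\<^sub>F q in at 0. q_coord s (Z q) = q \<and> q \<noteq> 0"
    using mirror_map by (auto simp: is_mirror_map_def eventually_at_filter elim: eventually_mono)
  hence "\<forall>\<^sub>F q in at 0. Z q \<noteq> 0"
    by (rule eventually_mono) (auto simp: q_coord_def)
  from eventually_exp[OF this] show ?thesis by (simp add: zt_def)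
qed

lemma zt_tendsto: "filterlim zt (at 0) at_left_infinity"
proof -
  have "Z \<midarrow>0\<rightarrow> 0"
    using analytic_at_imp_isCont[OF Z_analytic] by (simp add: isCont_def Z_0)
  from filterlim_compose[OF this filterlim_exp_at_left_infinity]
  have "(zt \<longlongrightarrow> 0) at_left_infinity" by (simp add: zt_def[abs_def])
  thus ?thesis using zt_nz by (simp add: filterlim_at)
qed

lemma eventually_zt: "eventually P (at 0) \<Longrightarrow> \<forall>\<^sub>F t in at_left_infinity. P (zt t)"
  using zt_tendsto by (auto simp: filterlim_iff)

lemma zt_small:
  "\<forall>\<^sub>F t in at_left_infinity. ereal (norm (zt t)) < fps_conv_radius (mirror_fps s) \<and>
     ereal (norm (zt t)) < fps_conv_radius (mirror_log_fps s)"
proof -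
  obtain R where R: "R > 0" "fps_conv_radius (mirror_fps s) \<ge> ereal R"
    "fps_conv_radius (mirror_log_fps s) \<ge> ereal R"
    using mirror_conv_radius[of s] s by auto
  have "\<forall>\<^sub>F w in at 0. norm (w :: complex) < R"
    unfolding eventually_at using R(1) by (auto simp: dist_norm)
  hence "\<forall>\<^sub>F w in at (0 :: complex). ereal (norm w) < fps_conv_radius (mirror_fps s) \<and>
     ereal (norm w) < fps_conv_radius (mirror_log_fps s)"
    by (rule eventually_mono) (use R(2,3) in \<open>auto intro: less_le_trans[of _ "ereal R"]\<close>)
  thus ?thesis by (rule eventually_zt)
qed

lemma meromorphic_eval_fps:
  assumes "fps_conv_radius F > 0"
  shows "meromorphic_in_exp (\<lambda>t. eval_fps F (zt t))"
proof -
  have "eval_fps F analytic_on Z ` {0}"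
    using assms by (intro analytic_on_eval_fps) (auto simp: Z_0 zero_ereal_def)
  with Z_analytic have "eval_fps F \<circ> Z analytic_on {0}"
    by (rule analytic_on_compose)
  hence "eval_fps F \<circ> Z meromorphic_on {0}"
    by (rule analytic_on_imp_meromorphic_on)
  thus ?thesis
    unfolding meromorphic_in_exp_def zt_def by (intro exI[of _ "eval_fps F \<circ> Z"]) simp
qed

lemma meromorphic_zt: "meromorphic_in_exp zt"
  using meromorphic_eval_fps[of fps_X] by simp

lemma zt_has_field_derivative:
  "\<forall>\<^sub>F t in at_left_infinity. (zt has_field_derivative \<omega> t * zt t) (at t)"
  using meromorphic_in_exp_deriv(2)[OF meromorphic_zt] zt_nz
  by eventually_elim (simp add: \<omega>_def)

text \<open>Differentiating \<open>q_coord s (zt t) = exp t\<close> exhibits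
  \<open>deriv zt t\<close> as a factor of \<open>exp t\<close>.\<close>

lemma deriv_zt_nz: "\<forall>\<^sub>F t in at_left_infinity. deriv zt t \<noteq> 0"
proof -
  obtain r where r: "r > 0" "q_coord s holomorphic_on ball 0 r"
    using q_coord_local[of s] s by auto
  have "\<forall>\<^sub>F w in at 0. w \<in> ball (0 :: complex) r"
    using r(1) by (intro eventually_at_in_open') auto
  hence small: "\<forall>\<^sub>F t in at_left_infinity. zt t \<in> ball 0 r"
    by (rule eventually_zt)
  have "\<forall>\<^sub>F q in at 0. q_coord s (Z q) = q"
    using mirror_map by (auto simp: is_mirror_map_def eventually_at_filter elim: eventually_mono)
  from eventually_exp[OF this] have "\<forall>\<^sub>F t in at_left_infinity. exp t = q_coord s (zt t)"
    by (simp add: zt_def eq_commute)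
  from eventually_has_field_derivative_cong[OF this, of exp]
  have "\<forall>\<^sub>F t in at_left_infinity. ((\<lambda>t. q_coord s (zt t)) has_field_derivative exp t) (at t)"
    by simp
  with small meromorphic_in_exp_deriv(2)[OF meromorphic_zt] show ?thesis
  proof eventually_elim
    case (elim t)
    have "(q_coord s has_field_derivative deriv (q_coord s) (zt t)) (at (zt t))"
      using r(2) elim(1) by (intro holomorphic_derivI[of _ "ball 0 r"]) auto
    from DERIV_unique[OF DERIV_chain2[OF this elim(2)] elim(3)] show ?case by auto
  qed
qed

lemma \<omega>_nz: "\<forall>\<^sub>F t in at_left_infinity. \<omega> t \<noteq> 0"
  using zt_nz deriv_zt_nz by eventually_elim (simp add: \<omega>_def)

lemma conv_radius_pos:
  "fps_conv_radius ((fps_theta ^^ k) (mirror_fps s)) > 0"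
  "fps_conv_radius ((fps_theta ^^ k) (mirror_log_fps s)) > 0"
proof -
  obtain R where R: "R > 0" "fps_conv_radius (mirror_fps s) \<ge> ereal R"
    "fps_conv_radius (mirror_log_fps s) \<ge> ereal R"
    using mirror_conv_radius[of s] s by auto
  have "0 < ereal R" using R(1) by simp
  with R(2,3) show "fps_conv_radius ((fps_theta ^^ k) (mirror_fps s)) > 0"
    "fps_conv_radius ((fps_theta ^^ k) (mirror_log_fps s)) > 0"
    using fps_conv_radius_theta_power by (metis less_le_trans)+
qed

lemma jet_chain_eval_theta:
  assumes "\<forall>\<^sub>F t in at_left_infinity. ereal (norm (zt t)) < fps_conv_radius F"
  shows "jet_chain \<omega> (\<lambda>k t. eval_fps ((fps_theta ^^ k) F) (zt t))"
  unfolding jet_chain_def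
proof
  fix k
  show "\<forall>\<^sub>F t in at_left_infinity. ((\<lambda>t. eval_fps ((fps_theta ^^ k) F) (zt t))
      has_field_derivative \<omega> t * eval_fps ((fps_theta ^^ Suc k) F) (zt t)) (at t)"
    using assms zt_has_field_derivative
  proof eventually_elim
    case (elim t)
    from elim(1) fps_conv_radius_theta_power[of F k]
    have "ereal (norm (zt t)) < fps_conv_radius ((fps_theta ^^ k) F)" by (rule less_le_trans)
    then obtain D where D: "(eval_fps ((fps_theta ^^ k) F) has_field_derivative D) (at (zt t))"
      "zt t * D = eval_fps (fps_theta ((fps_theta ^^ k) F)) (zt t)"
      by (rule has_field_derivative_eval_theta)
    from DERIV_chain2[OF D(1) elim(2)] show ?case
      by (simp add: D(2)[symmetric] mult_ac)
  qed
qed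

lemma jet_chain_U: "jet_chain \<omega> U"
  unfolding U_def[abs_def] using zt_small
  by (intro jet_chain_eval_theta) (auto elim: eventually_mono)

lemma jet_chain_W: "jet_chain \<omega> W"
  unfolding W_def[abs_def] using zt_small
  by (intro jet_chain_eval_theta) (auto elim: eventually_mono)

lemma U_0_nz: "\<forall>\<^sub>F t in at_left_infinity. U 0 t \<noteq> 0"
proof -
  have "isCont (eval_fps (mirror_fps s)) 0"
    using conv_radius_pos(1)[of 0] by (intro continuous_eval_fps) (auto simp: zero_ereal_def)
  hence "eval_fps (mirror_fps s) \<midarrow>0\<rightarrow> 1"
    by (simp add: isCont_def eval_fps_at_0 mirror_fps_def mirror_coeff_def)
  hence "\<forall>\<^sub>F w in at 0. eval_fps (mirror_fps s) w \<noteq> 0"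
    by (rule tendsto_imp_eventually_ne) simp
  from eventually_zt[OF this] show ?thesis by (simp add: U_def)
qed

section \<open>The logarithmic solution along the mirror map\<close>

text \<open>A branch of \<open>log z\<close>, so that \<open>V 0\<close> below is the second solution \<open>f\<^sub>1 = t f\<^sub>0\<close>.\<close>

definition w :: "complex \<Rightarrow> complex" where
  "w t = t - W 0 t / U 0 t"

text \<open>Since \<delta> \<open>w\<close> = 1, the Leibniz rule for the \<open>k\<close>-th
  \<delta>-derivative of \<open>w * f0\<close> stops after two terms.\<close>

definition V :: "nat \<Rightarrow> complex \<Rightarrow> complex" where
  "V k t = w t * U k t + of_nat k * U (k - 1) t + W k t"

lemma exp_w: "\<forall>\<^sub>F t in at_left_infinity. exp (w t) = zt t"
proof -
  have "\<forall>\<^sub>F q in at 0. q_coord s (Z q) = q"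
    using mirror_map by (auto simp: is_mirror_map_def eventually_at_filter elim: eventually_mono)
  from eventually_exp[OF this] zt_small show ?thesis
  proof eventually_elim
    case (elim t)
    have "exp t = zt t * exp (W 0 t / U 0 t)"
      using elim by (simp add: q_coord_def zt_def[symmetric] f0_eq_eval_fps g1_eq_eval_fps U_def W_def)
    thus ?case by (simp add: w_def exp_diff)
  qed
qed

text \<open>From \<open>exp w = z\<close> one gets \<open>w' = z' / z\<close>. As \<open>w\<close>
  contains \<open>t\<close>, differentiability comes from the meromorphic part
  \<open>W 0 / U 0\<close>.\<close>

lemma w_has_field_derivative:
  "\<forall>\<^sub>F t in at_left_infinity. (w has_field_derivative \<omega> t) (at t)"
proof -
  have "meromorphic_in_exp (U 0)" "meromorphic_in_exp (W 0)"
    unfolding U_def[abs_def] W_def[abs_def] by (intro meromorphic_eval_fps conv_radius_pos)+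
  hence "meromorphic_in_exp (\<lambda>t. W 0 t / U 0 t)"
    unfolding divide_inverse by (intro meromorphic_in_exp_mult meromorphic_in_exp_inverse)
  note * = meromorphic_in_exp_deriv(2)[OF this]
  have "\<forall>\<^sub>F t in at_left_infinity. (w has_field_derivative 1 - deriv (\<lambda>t. W 0 t / U 0 t) t) (at t)"
    using * by eventually_elim (auto simp: w_def[abs_def] intro!: DERIV_diff DERIV_ident)
  moreover from this have "\<forall>\<^sub>F t in at_left_infinity. ((\<lambda>t. exp (w t)) has_field_derivative
      exp (w t) * (1 - deriv (\<lambda>t. W 0 t / U 0 t) t)) (at t)"
    by eventually_elim (rule DERIV_chain2[OF DERIV_exp])
  from eventually_has_field_derivative_cong[OF exp_w this]
  have "\<forall>\<^sub>F t in at_left_infinity. (zt has_field_derivative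
      exp (w t) * (1 - deriv (\<lambda>t. W 0 t / U 0 t) t)) (at t)" .
  ultimately show ?thesis using zt_has_field_derivative exp_w zt_nz
  proof eventually_elim
    case (elim t)
    from DERIV_unique[OF elim(2,3)] elim(4,5)
    have "1 - deriv (\<lambda>t. W 0 t / U 0 t) t = \<omega> t" by simp
    with elim(1) show ?case by simp
  qed
qed

lemma jet_chain_V: "jet_chain \<omega> V"
  unfolding jet_chain_def
proof
  fix k
  have "\<forall>\<^sub>F t in at_left_infinity. (U k has_field_derivative \<omega> t * U (Suc k) t) (at t)"
    "\<forall>\<^sub>F t in at_left_infinity. (U (k - 1) has_field_derivative \<omega> t * U (Suc (k - 1)) t) (at t)"
    "\<forall>\<^sub>F t in at_left_infinity. (W k has_field_derivative \<omega> t * W (Suc k) t) (at t)"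
    using jet_chain_U jet_chain_W unfolding jet_chain_def by blast+
  with w_has_field_derivative
  show "\<forall>\<^sub>F t in at_left_infinity. (V k has_field_derivative \<omega> t * V (Suc k) t) (at t)"
  proof eventually_elim
    case (elim t)
    \<comment> \<open>For \<open>k = 0\<close> the truncated index is wrong, but the factor is
      0.\<close>
    have "of_nat k * U (Suc (k - 1)) t = of_nat k * U k t" by (cases k) auto
    hence eq: "\<omega> t * V (Suc k) t = (\<omega> t * U k t + (\<omega> t * U (Suc k) t) * w t) +
        of_nat k * (\<omega> t * U (Suc (k - 1)) t) + \<omega> t * W (Suc k) t"
      by (auto simp: V_def algebra_simps)
    have "V k = (\<lambda>t. w t * U k t + of_nat k * U (k - 1) t + W k t)"
      by (auto simp: V_def)
    thus ?case
      unfolding eq by (simp only:) (intro DERIV_add DERIV_mult DERIV_cmult elim)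
  qed
qed

text \<open>For \<open>V\<close>, add \<open>w\<close> times the equation of \<open>U\<close> to the
  second identity of \<open>mirror_ode\<close>.\<close>

lemma mirror_relation:
  shows "\<forall>\<^sub>F t in at_left_infinity.
      U (s - 1) t = zt t * (\<Sum>i\<le>s - 1. coeff (mirror_poly s) i * U i t)"
    and "\<forall>\<^sub>F t in at_left_infinity.
      V (s - 1) t = zt t * (\<Sum>i\<le>s - 1. coeff (mirror_poly s) i * V i t)"
proof -
  have U: "\<forall>\<^sub>F t in at_left_infinity.
      U (s - 1) t = zt t * (\<Sum>i\<le>s - 1. coeff (mirror_poly s) i * U i t)"
    using zt_small
  proof eventually_elim
    case (elim t)
    with mirror_ode(1)[OF s, of "zt t"] show ?case by (simp add: U_def)
  qed
  have W: "\<forall>\<^sub>F t in at_left_infinity. W (s - 1) t + of_nat (s - 1) * U (s - 2) t =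
      zt t * (\<Sum>i\<le>s - 1. coeff (mirror_poly s) i * (W i t + of_nat i * U (i - 1) t))"
    using zt_small
  proof eventually_elim
    case (elim t)
    with mirror_ode(2)[OF s, of "zt t"] show ?case by (simp only: U_def W_def)
  qed
  from U W have "\<forall>\<^sub>F t in at_left_infinity.
      V (s - 1) t = zt t * (\<Sum>i\<le>s - 1. coeff (mirror_poly s) i * V i t)"
  proof eventually_elim
    case (elim t)
    have "(\<Sum>i\<le>s - 1. coeff (mirror_poly s) i * V i t) =
        w t * (\<Sum>i\<le>s - 1. coeff (mirror_poly s) i * U i t) +
        (\<Sum>i\<le>s - 1. coeff (mirror_poly s) i * (W i t + of_nat i * U (i - 1) t))"
      by (simp add: V_def sum_distrib_left sum.distrib[symmetric] algebra_simps)
    hence "zt t * (\<Sum>i\<le>s - 1. coeff (mirror_poly s) i * V i t) =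
        w t * U (s - 1) t + (W (s - 1) t + of_nat (s - 1) * U (s - 2) t)"
      unfolding elim by (simp add: distrib_left mult.left_commute)
    moreover have "s - 1 - 1 = s - 2" by simp
    ultimately show ?case by (simp only: V_def) (simp add: add_ac)
  qed
  with U show "\<forall>\<^sub>F t in at_left_infinity.
      U (s - 1) t = zt t * (\<Sum>i\<le>s - 1. coeff (mirror_poly s) i * U i t)"
    "\<forall>\<^sub>F t in at_left_infinity.
      V (s - 1) t = zt t * (\<Sum>i\<le>s - 1. coeff (mirror_poly s) i * V i t)" by blast+
qed

lemma singularity_avoided: "\<forall>\<^sub>F t in at_left_infinity. 1 - of_nat s ^ s * zt t \<noteq> 0"
proof -
  have "((\<lambda>y. 1 - of_nat s ^ s * y) \<longlongrightarrow> 1 - of_nat s ^ s * 0) (at (0 :: complex))"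
    by (intro tendsto_intros)
  hence "\<forall>\<^sub>F y in at (0 :: complex). 1 - of_nat s ^ s * y \<noteq> 0"
    by (rule tendsto_imp_eventually_ne) simp
  thus ?thesis by (rule eventually_zt)
qed

definition r :: "nat \<Rightarrow> complex \<Rightarrow> complex" where
  "r i y = coeff (mirror_poly s) i * (y * inverse (1 - of_nat s ^ s * y))"

lemma r_ratfun: "r i \<in> ratfun (of_nat s ^ s)"
  unfolding r_def[abs_def] by (intro ratfun.mult ratfun.const ratfun.id ratfun.inverse)

text \<open>The term \<open>i = s - 1\<close> has coefficient \<open>s ^ s\<close>; moving it to the
  left produces the factor \<open>1 - s ^ s * z\<close>.\<close>

lemma solved_relation:
  assumes "\<forall>\<^sub>F t in at_left_infinity.
      Y (s - 1) t = zt t * (\<Sum>i\<le>s - 1. coeff (mirror_poly s) i * Y i t)"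
  shows "\<forall>\<^sub>F t in at_left_infinity. Y (s - 1) t = (\<Sum>i<s - 1. r i (zt t) * Y i t)"
  using assms singularity_avoided
proof eventually_elim
  case (elim t)
  have "{..s - 1} = insert (s - 1) {..<s - 1}" by auto
  with elim(1) have "Y (s - 1) t = zt t * (of_nat s ^ s * Y (s - 1) t +
      (\<Sum>i<s - 1. coeff (mirror_poly s) i * Y i t))"
    using lead_coeff_mirror_poly[of s] s by simp
  hence "Y (s - 1) t * (1 - of_nat s ^ s * zt t) =
      zt t * (\<Sum>i<s - 1. coeff (mirror_poly s) i * Y i t)"
    by (simp add: algebra_simps)
  hence "Y (s - 1) t = zt t * (\<Sum>i<s - 1. coeff (mirror_poly s) i * Y i t) /
      (1 - of_nat s ^ s * zt t)"
    using elim(2) by (simp add: eq_divide_eq)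
  thus ?case
    by (simp add: r_def sum_distrib_left divide_inverse mult_ac)
qed

lemma x_0: "x 0 = zt" and x_1: "x (Suc 0) = (\<lambda>t. 1 / \<omega> t)"
  and x_Suc_Suc: "x (Suc (Suc j)) = (\<lambda>t. deriv (x (Suc j)) t / \<omega> t)"
  by (simp_all add: x_def)

lemma meromorphic_\<omega>: "meromorphic_in_exp \<omega>"
  unfolding \<omega>_def[abs_def] divide_inverse
  by (intro meromorphic_in_exp_mult meromorphic_in_exp_inverse meromorphic_in_exp_deriv(1) meromorphic_zt)

lemma meromorphic_x: "meromorphic_in_exp (x j)"
proof (cases j)
  case 0
  thus ?thesis by (simp add: x_0 meromorphic_zt)
next
  case (Suc i)
  have "meromorphic_in_exp (x (Suc i))"
  proof (induction i)
    case 0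
    show ?case
      using meromorphic_in_exp_inverse[OF meromorphic_\<omega>] by (simp add: x_1 inverse_eq_divide)
  next
    case (Suc i)
    from meromorphic_in_exp_mult[OF meromorphic_in_exp_deriv(1)[OF Suc]
        meromorphic_in_exp_inverse[OF meromorphic_\<omega>]]
    show ?case by (simp add: x_Suc_Suc divide_inverse)
  qed
  with Suc show ?thesis by simp
qed

text \<open>The true \<delta>-jet of \<open>t\<close>. It differs from \<open>x\<close> at index 0,
  where \<open>x\<close> holds \<open>z\<close>.\<close>

definition \<tau> :: "nat \<Rightarrow> complex \<Rightarrow> complex" where
  "\<tau> j = (if j = 0 then (\<lambda>t. t) else x j)"

lemma jet_chain_\<tau>: "jet_chain \<omega> \<tau>"
  unfolding jet_chain_def
proof
  fix k
  show "\<forall>\<^sub>F t in at_left_infinity. (\<tau> k has_field_derivative \<omega> t * \<tau> (Suc k) t) (at t)"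
  proof (cases k)
    case 0
    show ?thesis
      using \<omega>_nz by eventually_elim (simp add: 0 \<tau>_def x_1)
  next
    case (Suc i)
    show ?thesis
      using \<omega>_nz meromorphic_in_exp_deriv(2)[OF meromorphic_x[of "Suc i"]]
      by eventually_elim (simp add: Suc \<tau>_def x_Suc_Suc)
  qed
qed

text \<open>The same solution seen twice: built from log \<open>z\<close> it satisfies the
  differential equation, and as \<open>t * U 0\<close> it brings in the \<tau>_j. Both are
  \<delta>-jets with the same initial term.\<close>

lemma V_eq_leibniz:
  "\<forall>\<^sub>F t in at_left_infinity. V k t = (\<Sum>j\<le>k. of_nat (k choose j) * \<tau> j t * U (k - j) t)"
proof (rule jet_chain_unique[OF jet_chain_V jet_chain_mult[OF jet_chain_\<tau> jet_chain_U] \<omega>_nz])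
  show "\<forall>\<^sub>F t in at_left_infinity. V 0 t = (\<Sum>j\<le>0. of_nat (0 choose j) * \<tau> j t * U (0 - j) t)"
    using U_0_nz by eventually_elim (simp add: V_def w_def \<tau>_def field_simps)
qed

text \<open>d/dt = \<omega> \<delta>, and \<omega> is the inverse of \<open>x 1\<close>.\<close>

lemma deriv_x_germ_field:
  assumes "j \<le> m"
  shows "deriv (x j) \<in> germ_field (x ` {..Suc m})"
proof -
  have "(\<lambda>t. (if j = 0 then x 0 t else x (Suc j) t) / x (Suc 0) t) \<in> germ_field (x ` {..Suc m})"
    using assms by (cases "j = 0") (simp_all, (intro germ_field_divide germ_field.gen; force)+)
  moreover have "\<forall>\<^sub>F t in at_left_infinity.
      (if j = 0 then x 0 t else x (Suc j) t) / x (Suc 0) t = deriv (x j) t"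
  proof (cases j)
    case 0
    show ?thesis
      using zt_nz by eventually_elim (simp add: 0 x_0 x_1 \<omega>_def)
  next
    case (Suc i)
    show ?thesis
      using \<omega>_nz by eventually_elim (simp add: Suc x_1 x_Suc_Suc)
  qed
  ultimately show ?thesis by (rule germ_field.cong)
qed

lemma x_top_germ_field: "x (2 * s - 3) \<in> germ_field (x ` {..2 * s - 4})"
proof -
  define n where "n = s - 1"
  have n: "n \<ge> 2" "s - 1 = n" "2 * s - 3 = 2 * n - 1" "2 * s - 4 = 2 * n - 2"
    using s by (auto simp: n_def)
  define S :: complex where "S = of_nat s ^ s"
  have "\<forall>m. \<exists>b. (\<forall>i. b i \<in> ratfun S) \<and> (m < n \<longrightarrow> (\<forall>i y. b i y = (if i = m then 1 else 0))) \<and>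
    (\<forall>Y. jet_chain \<omega> Y \<and> (\<forall>\<^sub>F t in at_left_infinity. Y n t = (\<Sum>i<n. r i (zt t) * Y i t)) \<longrightarrow>
      (\<forall>\<^sub>F t in at_left_infinity. Y m t = (\<Sum>i<n. b i (zt t) * Y i t)))"
    using n(1) zt_has_field_derivative \<omega>_nz singularity_avoided r_ratfun
    by (intro allI jet_chain_reduction) (auto simp: S_def)
  from choice[OF this] obtain \<beta> where \<beta>: "\<And>m i. \<beta> m i \<in> ratfun S"
    and \<beta>_unit: "\<And>m i y. m < n \<Longrightarrow> \<beta> m i y = (if i = m then 1 else 0)"
    and red: "\<And>m Y. jet_chain \<omega> Y \<Longrightarrow>
      \<forall>\<^sub>F t in at_left_infinity. Y n t = (\<Sum>i<n. r i (zt t) * Y i t) \<Longrightarrow>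
      \<forall>\<^sub>F t in at_left_infinity. Y m t = (\<Sum>i<n. \<beta> m i (zt t) * Y i t)"
    by blast
  have redU: "\<forall>\<^sub>F t in at_left_infinity. U m t = (\<Sum>i<n. \<beta> m i (zt t) * U i t)" for m
    by (intro red jet_chain_U solved_relation[unfolded n(2)] mirror_relation(1)[unfolded n(2)])
  have redV: "\<forall>\<^sub>F t in at_left_infinity. V m t = (\<Sum>i<n. \<beta> m i (zt t) * V i t)" for m
    by (intro red jet_chain_V solved_relation[unfolded n(2)] mirror_relation(2)[unfolded n(2)])
  have rel: "\<forall>\<^sub>F t in at_left_infinity. (\<Sum>i<n.
      relation_coeff n (\<lambda>m i. \<beta> m i (x 0 t)) (\<lambda>i. x i t) (n + k) i * U i t) = 0" for k
  proof -
    have "\<forall>\<^sub>F t in at_left_infinity. \<forall>l\<in>{..n + k}.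
        V l t = (\<Sum>j\<le>l. of_nat (l choose j) * \<tau> j t * U (l - j) t)"
      by (rule eventually_ball_finite) (use V_eq_leibniz in auto)
    moreover have "\<forall>\<^sub>F t in at_left_infinity. \<forall>l\<in>{..n + k}. U l t = (\<Sum>i<n. \<beta> l i (zt t) * U i t)"
      by (rule eventually_ball_finite) (use redU in auto)
    ultimately show ?thesis using redV[of "n + k"]
    proof eventually_elim
      case (elim t)
      have "(\<Sum>i<n. relation_coeff n (\<lambda>m i. \<beta> m i (zt t)) (\<lambda>i. \<tau> i t) (n + k) i * U i t) = 0"
        by (rule relation_coeff_eq_0[where V = "\<lambda>l. V l t"]) (use elim in auto)
      moreover have "relation_coeff n (\<lambda>m i. \<beta> m i (zt t)) (\<lambda>i. \<tau> i t) (n + k) i =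
          relation_coeff n (\<lambda>m i. \<beta> m i (zt t)) (\<lambda>i. x i t) (n + k) i" for i
        by (rule relation_coeff_cong) (auto simp: \<tau>_def)
      ultimately show ?case by (simp add: x_0)
    qed
  qed
  have "x (2 * n - 1) \<in> germ_field (x ` {..2 * n - 2}) \<or>
      (\<exists>m<2 * n - 1. algebraic_germ (x ` {..<m}) (x m))"
    by (rule top_variable_generated_or_algebraic[where U = U and \<beta> = \<beta> and S = S])
       (use n(1) \<beta> \<beta>_unit meromorphic_x rel U_0_nz singularity_avoided in \<open>simp_all add: x_0 S_def\<close>)
  moreover have "x (2 * n - 1) \<in> germ_field (x ` {..2 * n - 2})"
    if m: "m < 2 * n - 1" and alg: "algebraic_germ (x ` {..<m}) (x m)" for m
  proof -
    \<comment> \<open>Index 0 must be excluded because \<open>x 1\<close> is not obtained by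
      applying \<delta> to \<open>x 0\<close>.\<close>
    have "m \<noteq> 0"
    proof
      assume "m = 0"
      with alg have "algebraic_germ {} zt" by (simp add: x_0)
      with not_algebraic_germ_empty[OF zt_tendsto] show False by blast
    qed
    then obtain m' where m': "m = Suc m'" by (cases m) auto
    have \<omega>_field: "\<omega> \<in> germ_field (x ` {..k})" if "k \<ge> 1" for k
    proof -
      have "(\<lambda>t. inverse (x (Suc 0) t)) \<in> germ_field (x ` {..k})"
        using that by (intro germ_field.inverse germ_field.gen) auto
      thus ?thesis by (simp add: x_1 inverse_eq_divide)
    qed
    have "deriv (x m) \<in> germ_field (x ` {..m})"
    proof (rule algebraic_germ_deriv[OF alg])
      fix g assume "g \<in> x ` {..<m}"
      then obtain j where "g = x j" "j \<le> m'" by (auto simp: m' less_Suc_eq_le)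
      thus "deriv g \<in> germ_field (x ` {..m})" unfolding m' by (auto intro: deriv_x_germ_field)
    qed (auto intro: germ_field.gen meromorphic_x)
    hence "(\<lambda>t. deriv (x m) t / \<omega> t) \<in> germ_field (x ` {..m})"
      using \<omega>_field[of m] m' by (intro germ_field_divide) auto
    hence base: "x (Suc m) \<in> germ_field (x ` {..m})"
      by (simp add: m' x_Suc_Suc)
    \<comment> \<open>Rationality propagates upwards: differentiating an expression for
      \<open>x (Suc k)\<close> in earlier variables involves nothing beyond
      \<open>x (Suc k)\<close>.\<close>
    have "x (Suc k) \<in> germ_field (x ` {..k})" if "m \<le> k" for k
      using that
    proof (induction k rule: dec_induct)
      case base
      show ?case by (rule \<open>x (Suc m) \<in> _\<close>)
    next
      case (step k)
      have "deriv (x (Suc k)) \<in> germ_field (x ` {..Suc k})"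
      proof (rule germ_field_deriv[OF step.IH])
        fix g assume "g \<in> x ` {..k}"
        thus "deriv g \<in> germ_field (x ` {..Suc k})" by (auto intro: deriv_x_germ_field)
      qed (auto intro: germ_field.gen meromorphic_x)
      hence "(\<lambda>t. deriv (x (Suc k)) t / \<omega> t) \<in> germ_field (x ` {..Suc k})"
        using \<omega>_field[of "Suc k"] by (intro germ_field_divide) auto
      thus ?case by (simp add: x_Suc_Suc)
    qed
    from this[of "2 * n - 2"] show ?thesis
      using m n(1) by (simp add: Suc_diff_Suc numeral_2_eq_2)
  qed
  ultimately show ?thesis unfolding n(3,4) by blast
qed

section \<open>Comparison of the \<delta>-derivatives of \<open>t\<close> with the
  \<open>t\<close>-derivatives of \<open>z\<close>\<close>

definition jets :: "nat \<Rightarrow> (complex \<Rightarrow> complex) set" where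
  "jets m = (\<lambda>k. (deriv ^^ k) zt) ` {..m}"

lemma meromorphic_jet: "meromorphic_in_exp ((deriv ^^ k) zt)"
  by (induction k) (auto intro: meromorphic_zt meromorphic_in_exp_deriv(1))

lemma jet_in_x_field: "(deriv ^^ k) zt \<in> germ_field (x ` {..k})"
proof (induction k)
  case 0
  show ?case by (rule germ_field.gen) (simp add: x_0)
next
  case (Suc k)
  have "deriv ((deriv ^^ k) zt) \<in> germ_field (x ` {..Suc k})"
    by (rule germ_field_deriv[OF Suc])
       (auto intro: deriv_x_germ_field germ_field.gen meromorphic_x)
  thus ?case by simp
qed

text \<open>\<open>x 1 = z / z'\<close> uses one derivative of \<open>z\<close>, and each further
  \<delta> costs one more.\<close>

lemma x_in_jet_field: "x (Suc j) \<in> germ_field (jets (Suc j))"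
proof -
  have jet: "(deriv ^^ k) zt \<in> germ_field (jets m)" if "k \<le> m" for k m
    using that by (auto simp: jets_def intro: germ_field.gen)
  have \<omega>: "\<omega> \<in> germ_field (jets m)" if "m \<ge> 1" for m
    unfolding \<omega>_def[abs_def] using jet[of 0 m] jet[of 1 m] that by (auto intro: germ_field_divide)
  show ?thesis
  proof (induction j)
    case 0
    show ?case unfolding x_1 by (intro germ_field_divide germ_field.const \<omega>) simp
  next
    case (Suc j)
    have "deriv (x (Suc j)) \<in> germ_field (jets (Suc (Suc j)))"
    proof (rule germ_field_deriv[OF Suc])
      fix g assume "g \<in> jets (Suc j)"
      then obtain k where "k \<le> Suc j" "g = (deriv ^^ k) zt" by (auto simp: jets_def)
      thus "deriv g \<in> germ_field (jets (Suc (Suc j)))"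
        using jet[of "Suc k" "Suc (Suc j)"] by simp
    qed (auto simp: jets_def intro: germ_field.gen meromorphic_jet)
    thus ?case unfolding x_Suc_Suc by (intro germ_field_divide \<omega>) auto
  qed
qed

text \<open>The two families generate the same field at each positive order, so the drop by one
  order found for \<open>x\<close> carries over to the jets of \<open>z\<close>.\<close>

lemma jet_top: "(deriv ^^ (2 * s - 3)) zt \<in> germ_field (jets (2 * s - 4))"
proof -
  define m where "m = 2 * s - 4"
  have m: "2 * s - 3 = Suc m" "2 * s - 4 = m" using s by (auto simp: m_def)
  have "x j \<in> germ_field (jets m)" if "j \<le> m" for j
  proof (cases j)
    case 0
    have "zt \<in> jets m" unfolding jets_def by (rule image_eqI[of _ _ 0]) auto
    thus ?thesis by (simp add: 0 x_0 germ_field.gen)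
  next
    case (Suc i)
    have "jets (Suc i) \<subseteq> jets m" using that Suc by (auto simp: jets_def)
    from germ_field_mono[OF this] x_in_jet_field[of i] show ?thesis by (auto simp: Suc)
  qed
  hence "germ_field (x ` {..m}) \<subseteq> germ_field (jets m)"
    by (intro germ_field_least) auto
  moreover have "germ_field (x ` {..Suc m}) \<subseteq> germ_field (x ` {..m})"
    using x_top_germ_field unfolding m
    by (intro germ_field_least) (auto simp: atMost_Suc intro: germ_field.gen)
  ultimately show ?thesis
    using jet_in_x_field[of "Suc m"] unfolding m by blast
qed

end

theorem proposition1:
  fixes s :: nat and Z :: "complex \<Rightarrow> complex"
  assumes "s \<ge> 3" and "is_mirror_map s Z"
  defines "z \<equiv> (\<lambda>t. Z (exp t))"
  shows "satisfies_algebraic_ode (2 * s - 3) z \<and>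
         in_jet_field (2 * s - 4) z ((deriv ^^ (2 * s - 3)) z)"
proof -
  interpret mirror s Z by unfold_locales (fact assms)+
  have z: "z = zt" by (simp add: z_def zt_def[abs_def])
  have m: "2 * s - 3 = Suc (2 * s - 4)" using assms(1) by simp
  show ?thesis
    using germ_field_imp_algebraic_ode[of "2 * s - 4" zt] jet_top meromorphic_jet
    unfolding z m jets_def by blast
qed

end
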